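(* Suppose $\varepsilon(2+\varepsilon)<\gamma_0$, let $u^\varepsilon$ be the weak solution of $$-\Delta u^\varepsilon-k^2\alpha^2u^\varepsilon=f\ \text{ in } D,\qquad \partial_\nu u^\varepsilon+\mathbf{i}k\alpha u^\varepsilon=0\ \text{ on }\partial D,$$ with $f\in L^2(\Omega,L^2(D))$, and let $\{u_n\}_{n\ge0}\subset L^2(\Omega,H^1(D))$ be the mode functions, i.e. the weak solutions of $$-\Delta u_0-k^2u_0=f,\qquad -\Delta u_n-k^2u_n=2k^2\eta u_{n-1}+k^2\eta^2u_{n-2}\ (n\ge1)\quad\text{in } D,$$ $$\partial_\nu u_n+\mathbf{i}ku_n=-\mathbf{i}k\eta u_{n-1}\ (n\ge0)\quad\text{on }\partial D,\qquad u_{-1}:\equiv0.$$ Then the expansion $$u^\varepsilon=\sum_{n=0}^\infty\varepsilon^nu_n$$ is valid in $L^2(\Omega,H^1(D))$, provided that $\sigma:=4\varepsilon C_0^{1/2}(1+k)<1$.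
   Context: $D\subset B_1(0)\subset\mathbb{R}^d$ ($d\in\{1,2,3\}$) is a convex bounded polygonal domain with unit outward normal $\nu$, star-shaped with respect to the origin: there is $c_0>0$ with $x\cdot\nu\ge c_0$ on $\partial D$. It is assumed that $k\ge1$ and $\varepsilon>0$ (normalization: $k\ge 1$, $D\subset B_1(0)$, $R=1$). $(\Omega,\mathcal F,P)$ is a probability space with expectation $\mathbb{E}$. $\alpha=1+\varepsilon\eta$, where $\eta\in L^2(\Omega,L^\infty(D))$ is real-valued with $\|\eta(\omega,\cdot)\|_{L^\infty(D)}\le1$ almost surely, and the boundary values of $\eta$ on $\partial D$ are also bounded by $1$ in absolute value a.s. Function spaces are complex-valued; $(w,v)_D=\int_Dw\overline v\,dx$, $\langle w,v\rangle_{\partial D}=\int_{\partial D}w\overline v\,dS$. Weak solution of $-\Delta u-k^2\alpha^2u=f$ in $D$, $\partial_\nu u+\mathbf{i}k\alpha u=g$ on $\partial D$: $u\in L^2(\Omega,H^1(D))$ with $\int_\Omega\bigl[(\nabla u,\nabla v)_D-k^2(\alpha^2u,v)_D+\mathbf{i}k\langle\alpha u,v\rangle_{\partial D}\bigr]dP=\int_\Omega[(f,v)_D+\langle g,v\rangle_{\partial D}]\,dP$ for all $v\in L^2(\Omega,H^1(D))$. For the mode functions the same definition is used with $\alpha\equiv1$ and the respective right-hand sides. $\gamma_0:=\min\{1,\frac{13-2d}{2(4d-7)+25k}\}$. $C_0>0$ is a constant independent of $k$ and $u$ such that, whenever $\varepsilon\ge0$ and $\varepsilon(2+\varepsilon)<\gamma_0$,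 every weak solution $u$ with data $f\in L^2(\Omega,L^2(D))$, $g\in L^2(\Omega,L^2(\partial D))$ satisfies, with $M(f,g)=\mathbb{E}(\|f\|_{L^2(D)}^2+\|g\|_{L^2(\partial D)}^2)$, both $\mathbb{E}(\|u\|_{L^2(D)}^2+\|u\|_{L^2(\partial D)}^2+c_0\|\nabla u\|_{L^2(\partial D)}^2)\le C_0(\frac1k+\frac1{k^2})^2M(f,g)$ and $\mathbb{E}(\|u\|_{H^1(D)}^2)\le C_0(1+\frac1{k^2})^2M(f,g)$. *)

theory Defs
  imports "HOL-Probability.Probability" "HOL-Library.Function_Algebras"
begin

section \<open>Smooth functions and classical derivatives\<close>

definition partial :: "'n::finite \<Rightarrow> (real^'n \<Rightarrow> complex) \<Rightarrow> real^'n \<Rightarrow> complex" where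
  "partial i \<phi> x = frechet_derivative \<phi> (at x) (axis i 1)"

definition cgrad :: "(real^'n::finite \<Rightarrow> complex) \<Rightarrow> real^'n \<Rightarrow> complex^'n" where
  "cgrad \<phi> x = (\<chi> i. partial i \<phi> x)"

definition laplacian :: "(real^'n::finite \<Rightarrow> complex) \<Rightarrow> real^'n \<Rightarrow> complex" where
  "laplacian \<phi> x = (\<Sum>i\<in>UNIV. partial i (partial i \<phi>) x)"

text \<open>\<open>C\<^sup>\<infinity>(\<real>\<^sup>d)\<close>: all iterated partial derivatives exist and are differentiable.\<close>

coinductive smooth :: "(real^'n::finite \<Rightarrow> complex) \<Rightarrow> bool" where
  "(\<forall>x. \<phi> differentiable (at x)) \<Longrightarrow> (\<forall>i. smooth (partial i \<phi>)) \<Longrightarrow> smooth \<phi>"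

definition test_function :: "(real^'n::finite) set \<Rightarrow> (real^'n \<Rightarrow> complex) \<Rightarrow> bool" where
  "test_function D \<phi> \<longleftrightarrow> smooth \<phi> \<and>
     compact (closure {x. \<phi> x \<noteq> 0}) \<and> closure {x. \<phi> x \<noteq> 0} \<subseteq> D"


section \<open>Convex polygonal domains, outward normals, surface measure\<close>

text \<open>The unit outward normal \<open>\<nu>\<close> of \<open>D\<close> is constant on each facet of the polytope \<open>closure D\<close>.\<close>

definition outward_normal :: "'a::euclidean_space set \<Rightarrow> 'a set \<Rightarrow> 'a" where
  "outward_normal D F = (THE \<nu>. norm \<nu> = 1 \<and>
     (\<exists>b. F \<subseteq> {x. \<nu> \<bullet> x = b} \<and> D \<subseteq> {x. \<nu> \<bullet> x \<le> b}))"

definition convex_polygonal_domain :: "'a::euclidean_space set \<Rightarrow> bool" where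
  "convex_polygonal_domain D \<longleftrightarrow> open D \<and> D \<noteq> {} \<and> convex D \<and> polytope (closure D)"

definition star_shaped :: "'a::euclidean_space set \<Rightarrow> real \<Rightarrow> bool" where
  "star_shaped D c\<^sub>0 \<longleftrightarrow> (\<forall>F. F facet_of closure D \<longrightarrow> (\<forall>x\<in>F. c\<^sub>0 \<le> x \<bullet> outward_normal D F))"

text \<open>
  The measure \<open>dS\<close> on \<open>\<partial>D\<close>: the \<open>(d-1)\<close>-dimensional volume of a Borel subset of a facet is the
  \<open>d\<close>-dimensional volume of the right prism of height 1 over it (so for \<open>d = 1\<close> each of the two
  end points of the interval has mass 1).  Distinct facets meet in a set of measure 0.
\<close>

definition surface :: "'a::euclidean_space set \<Rightarrow> 'a measure" where
  "surface D = measure_of (frontier D) {A \<in> sets borel. A \<subseteq> frontier D}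
     (\<lambda>A. \<Sum>F | F facet_of closure D.
        emeasure lborel {x + s *\<^sub>R outward_normal D F | x s. x \<in> A \<inter> F \<and> 0 \<le> s \<and> s \<le> 1})"

text \<open>The next two lemmas confirm that the definite description and \<open>measure_of\<close> above are not degenerate.\<close>

lemma outward_normal_facet:
  assumes D: "convex_polygonal_domain D" and F: "F facet_of closure D"
  obtains b where "norm (outward_normal D F) = 1" "F \<subseteq> {x. outward_normal D F \<bullet> x = b}"
    "closure D \<subseteq> {x. outward_normal D F \<bullet> x \<le> b}"
proof -
  let ?P = "\<lambda>\<nu>. norm \<nu> = 1 \<and> (\<exists>b. F \<subseteq> {x. \<nu> \<bullet> x = b} \<and> D \<subseteq> {x. \<nu> \<bullet> x \<le> b})"
  have op: "open D" "D \<noteq> {}" "convex D" "polytope (closure D)"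
    using D by (auto simp: convex_polygonal_domain_def)
  have ad: "aff_dim D = DIM('a)" using op by (simp add: aff_dim_open)
  have adc: "aff_dim (closure D) = DIM('a)" using ad by simp
  have adF: "aff_dim F = DIM('a) - 1" and Fne: "F \<noteq> {}" using F adc by (auto simp: facet_of_def)
  have "F exposed_face_of closure D"
    using F op(4) exposed_face_of_polyhedron polytope_imp_polyhedron facet_of_imp_face_of by blast
  then obtain a b where ab: "closure D \<subseteq> {x. a \<bullet> x \<le> b}" "F = closure D \<inter> {x. a \<bullet> x = b}"
    unfolding exposed_face_of_def by blast
  have a0: "a \<noteq> 0"
  proof
    assume "a = 0"
    then have "F = closure D \<or> F = {}" using ab by (cases "b = 0") auto
    then show False using Fne adF adc by auto
  qed
  define \<nu> where "\<nu> = a /\<^sub>R norm a"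
  have n1: "norm \<nu> = 1" using a0 by (simp add: \<nu>_def)
  have cl: "closure D \<subseteq> {x. \<nu> \<bullet> x \<le> b / norm a}"
    using ab(1) a0 by (auto simp: \<nu>_def field_simps)
  have n2: "F \<subseteq> {x. \<nu> \<bullet> x = b / norm a}"
    using ab(2) a0 by (auto simp: \<nu>_def field_simps)
  have P\<nu>: "?P \<nu>" using n1 n2 cl closure_subset[of D] by blast
  have hyp: "affine hull F = {x. n \<bullet> x = c}" if n: "norm n = 1" "F \<subseteq> {x. n \<bullet> x = c}" for n :: 'a and c
  proof -
    have "n \<noteq> 0" using n by auto
    then have "aff_dim {x. n \<bullet> x = c} = DIM('a) - 1" by (simp add: aff_dim_hyperplane of_nat_diff)
    moreover have "affine {x. n \<bullet> x = c}" by (rule affine_hyperplane)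
    ultimately show ?thesis
      using n(2) adF Fne
      by (metis (lifting) aff_dim_affine_hull affine_affine_hull affine_dim_equal affine_hull_eq_empty hull_minimal)
  qed
  have uniq: "\<mu> = \<nu>" if mu: "?P \<mu>" for \<mu>
  proof -
    from mu obtain c where c: "norm \<mu> = 1" "F \<subseteq> {x. \<mu> \<bullet> x = c}" "D \<subseteq> {x. \<mu> \<bullet> x \<le> c}" by blast
    have eq: "{x. \<mu> \<bullet> x = c} = {x. \<nu> \<bullet> x = b / norm a}" using hyp[OF c(1,2)] hyp[OF n1 n2] by simp
    obtain x0 where x0: "x0 \<in> F" using Fne by auto
    define y where "y = \<mu> - (\<mu> \<bullet> \<nu>) *\<^sub>R \<nu>"
    have nn: "\<nu> \<bullet> \<nu> = 1" "\<mu> \<bullet> \<mu> = 1" using n1 c(1) by (auto simp: norm_eq_1)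
    have y: "\<nu> \<bullet> y = 0" by (simp add: y_def inner_diff_right nn inner_commute)
    have "x0 + y \<in> {x. \<nu> \<bullet> x = b / norm a}" using x0 n2 y by (auto simp: inner_add_right)
    then have "\<mu> \<bullet> (x0 + y) = c" using eq by blast
    moreover have "\<mu> \<bullet> x0 = c" using x0 c by auto
    ultimately have my: "\<mu> \<bullet> y = 0" by (simp add: inner_add_right)
    have "y \<bullet> y = \<mu> \<bullet> y - (\<mu> \<bullet> \<nu>) * (\<nu> \<bullet> y)" by (subst (1) y_def) (simp add: inner_diff_left)
    then have "y \<bullet> y = 0" using my y by simp
    then have mn: "\<mu> = (\<mu> \<bullet> \<nu>) *\<^sub>R \<nu>" by (simp add: y_def)
    then have "norm \<mu> = \<bar>\<mu> \<bullet> \<nu>\<bar> * norm \<nu>" by (metis norm_scaleR)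
    then have "\<mu> \<bullet> \<nu> = 1 \<or> \<mu> \<bullet> \<nu> = -1" using n1 c(1) by auto
    moreover have "\<mu> \<bullet> \<nu> \<noteq> -1"
    proof
      assume "\<mu> \<bullet> \<nu> = -1"
      then have m: "\<mu> = - \<nu>" using mn by simp
      have "\<mu> \<bullet> x0 = c" "\<nu> \<bullet> x0 = b / norm a" using x0 c(2) n2 by blast+
      then have "c = - (b / norm a)" using m by simp
      then have "D \<subseteq> {x. \<nu> \<bullet> x = b / norm a}" using c(3) m cl closure_subset[of D] by force
      then have "aff_dim D \<le> aff_dim {x. \<nu> \<bullet> x = b / norm a}" by (rule aff_dim_subset)
      moreover have "\<nu> \<noteq> 0" using n1 by auto
      ultimately show False using ad by (simp add: aff_dim_hyperplane of_nat_diff)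
    qed
    ultimately show ?thesis using mn by simp
  qed
  have "outward_normal D F = \<nu>" unfolding outward_normal_def
    by (rule the_equality[where P = ?P, OF P\<nu> uniq])
  then show ?thesis using that[of "b / norm a"] n1 n2 cl by simp
qed

lemma emeasure_surface:
  fixes D :: "'a::euclidean_space set"
  assumes D: "convex_polygonal_domain D" and A: "A \<in> sets borel" "A \<subseteq> frontier D"
  shows "emeasure (surface D) A = (\<Sum>F | F facet_of closure D.
     emeasure lborel {x + s *\<^sub>R outward_normal D F | x s. x \<in> A \<inter> F \<and> 0 \<le> s \<and> s \<le> 1})"
proof -
  define prism where "prism F A = {x + s *\<^sub>R outward_normal D F | x s. x \<in> A \<inter> F \<and> 0 \<le> s \<and> s \<le> 1}"
    for F A
  let ?S = "{A \<in> sets borel. A \<subseteq> frontier D}"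
  let ?\<mu> = "\<lambda>A. \<Sum>F | F facet_of closure D. emeasure lborel (prism F A)"
  have fr: "frontier D \<in> sets borel" by simp
  have sa: "sigma_algebra (frontier D) ?S"
  proof -
    have "?S = sets (restrict_space borel (frontier D))"
      using fr by (auto simp: sets_restrict_space_iff)
    then show ?thesis
      using sets.sigma_algebra_axioms[of "restrict_space borel (frontier D)"]
      by (simp add: space_restrict_space)
  qed
  have pr: "\<exists>b. \<forall>A. prism F A = {y. 0 \<le> \<nu> \<bullet> y - b \<and> \<nu> \<bullet> y - b \<le> 1 \<and> y - (\<nu> \<bullet> y - b) *\<^sub>R \<nu> \<in> A \<inter> F}"
    if F: "F facet_of closure D" and nu: "\<nu> = outward_normal D F" for F \<nu>
  proof -
    obtain b where b: "norm \<nu> = 1" "F \<subseteq> {x. \<nu> \<bullet> x = b}" using outward_normal_facet[OF D F] nu by metis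
    have nn: "\<nu> \<bullet> \<nu> = 1" using b(1) by (simp add: norm_eq_1)
    have "prism F A = {y. 0 \<le> \<nu> \<bullet> y - b \<and> \<nu> \<bullet> y - b \<le> 1 \<and> y - (\<nu> \<bullet> y - b) *\<^sub>R \<nu> \<in> A \<inter> F}" for A
    proof (intro equalityI subsetI)
      fix y assume "y \<in> prism F A"
      then obtain x s where "y = x + s *\<^sub>R \<nu>" "x \<in> A \<inter> F" "0 \<le> s" "s \<le> 1"
        unfolding prism_def nu by blast
      moreover have "\<nu> \<bullet> x = b" using calculation b(2) by auto
      ultimately show "y \<in> {y. 0 \<le> \<nu> \<bullet> y - b \<and> \<nu> \<bullet> y - b \<le> 1 \<and> y - (\<nu> \<bullet> y - b) *\<^sub>R \<nu> \<in> A \<inter> F}"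
        by (simp add: inner_add_right nn)
    next
      fix y assume y: "y \<in> {y. 0 \<le> \<nu> \<bullet> y - b \<and> \<nu> \<bullet> y - b \<le> 1 \<and> y - (\<nu> \<bullet> y - b) *\<^sub>R \<nu> \<in> A \<inter> F}"
      have "y = (y - (\<nu> \<bullet> y - b) *\<^sub>R \<nu>) + (\<nu> \<bullet> y - b) *\<^sub>R \<nu>" by simp
      with y show "y \<in> prism F A" unfolding prism_def nu by blast
    qed
    then show ?thesis by blast
  qed
  have meas: "prism F A \<in> sets borel" if F: "F facet_of closure D" and A: "A \<in> sets borel" for F A
  proof -
    define \<nu> where "\<nu> = outward_normal D F"
    obtain b where b: "\<And>A. prism F A = {y. 0 \<le> \<nu> \<bullet> y - b \<and> \<nu> \<bullet> y - b \<le> 1 \<and> y - (\<nu> \<bullet> y - b) *\<^sub>R \<nu> \<in> A \<inter> F}"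
      using pr[OF F \<nu>_def] by blast
    have "closed F" using F D
      by (meson convex_closure closed_closure convex_polygonal_domain_def face_of_imp_closed facet_of_imp_face_of)
    then have [measurable]: "A \<inter> F \<in> sets borel" using A by simp
    have [measurable]: "(\<lambda>y. y - (\<nu> \<bullet> y - b) *\<^sub>R \<nu>) \<in> borel_measurable borel"
      by (intro borel_measurable_continuous_onI continuous_intros)
    have [measurable]: "(\<lambda>y. \<nu> \<bullet> y - b) \<in> borel_measurable borel"
      by (intro borel_measurable_continuous_onI continuous_intros)
    have "{y \<in> space borel. 0 \<le> \<nu> \<bullet> y - b \<and> \<nu> \<bullet> y - b \<le> 1 \<and> y - (\<nu> \<bullet> y - b) *\<^sub>R \<nu> \<in> A \<inter> F} \<in> sets borel"
      by measurable
    then show ?thesis by (simp add: b)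
  qed
  have pos: "positive ?S ?\<mu>" by (simp add: positive_def prism_def)
  have ca: "countably_additive ?S ?\<mu>"
  proof (rule countably_additiveI)
    fix B :: "nat \<Rightarrow> 'a set"
    assume B: "range B \<subseteq> ?S" "disjoint_family B"
    have "(\<Sum>i. emeasure lborel (prism F (B i))) = emeasure lborel (prism F (\<Union>i. B i))"
      if F: "F facet_of closure D" for F
    proof -
      obtain b where b: "\<And>A. prism F A = {y. 0 \<le> outward_normal D F \<bullet> y - b \<and> outward_normal D F \<bullet> y - b \<le> 1 \<and> y - (outward_normal D F \<bullet> y - b) *\<^sub>R outward_normal D F \<in> A \<inter> F}"
        using pr[OF F refl] by blast
      have U: "prism F (\<Union>i. B i) = (\<Union>i. prism F (B i))" unfolding b by blast
      have "disjoint_family (\<lambda>i. prism F (B i))"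
        using B(2) unfolding b disjoint_family_on_def by blast
      moreover have "range (\<lambda>i. prism F (B i)) \<subseteq> sets lborel" using B(1) meas[OF F] by auto
      ultimately show ?thesis unfolding U by (intro suminf_emeasure) auto
    qed
    moreover have "(\<Sum>i. ?\<mu> (B i)) = (\<Sum>F | F facet_of closure D. \<Sum>i. emeasure lborel (prism F (B i)))"
      by (rule suminf_sum) (simp add: summableI)
    ultimately show "(\<Sum>i. ?\<mu> (B i)) = ?\<mu> (\<Union>i. B i)" by simp
  qed
  have "emeasure (measure_of (frontier D) ?S ?\<mu>) A = ?\<mu> A"
    by (rule emeasure_measure_of_sigma[OF sa pos ca]) (use A in auto)
  then show ?thesis unfolding surface_def prism_def by simp
qed


section \<open>\<open>L\<^sup>2\<close>, \<open>L\<^sup>\<infinity>\<close> and \<open>H\<^sup>1\<close>\<close>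

text \<open>
  Elements of these spaces are represented by functions, not by classes modulo null sets; the norms
  below are accordingly seminorms.
\<close>

definition L2 :: "'a measure \<Rightarrow> ('a \<Rightarrow> 'b::real_normed_vector) set" where
  "L2 \<mu> = {f \<in> borel_measurable \<mu>. integrable \<mu> (\<lambda>x. (norm (f x))\<^sup>2)}"

definition L2_norm :: "'a measure \<Rightarrow> ('a \<Rightarrow> 'b::real_normed_vector) \<Rightarrow> real" where
  "L2_norm \<mu> f = sqrt (\<integral>x. (norm (f x))\<^sup>2 \<partial>\<mu>)"

definition Linf :: "'a measure \<Rightarrow> ('a \<Rightarrow> real) set" where
  "Linf \<mu> = {f \<in> borel_measurable \<mu>. \<exists>C. AE x in \<mu>. \<bar>f x\<bar> \<le> C}"

definition Linf_norm :: "'a measure \<Rightarrow> ('a \<Rightarrow> real) \<Rightarrow> real" where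
  "Linf_norm \<mu> f = real_of_ereal (esssup \<mu> (\<lambda>x. ereal \<bar>f x\<bar>))"

definition L2_inner :: "'a measure \<Rightarrow> ('a \<Rightarrow> complex) \<Rightarrow> ('a \<Rightarrow> complex) \<Rightarrow> complex" where
  "L2_inner \<mu> w v = (\<integral>x. w x * cnj (v x) \<partial>\<mu>)"

definition L2_inner_vec ::
    "'a measure \<Rightarrow> ('a \<Rightarrow> complex^'n::finite) \<Rightarrow> ('a \<Rightarrow> complex^'n) \<Rightarrow> complex" where
  "L2_inner_vec \<mu> W V = (\<integral>x. (\<Sum>i\<in>UNIV. W x $ i * cnj (V x $ i)) \<partial>\<mu>)"

definition weak_gradient ::
    "(real^'n::finite) set \<Rightarrow> (real^'n \<Rightarrow> complex) \<Rightarrow> (real^'n \<Rightarrow> complex^'n) \<Rightarrow> bool" where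
  "weak_gradient D u G \<longleftrightarrow> (\<forall>\<phi> i. test_function D \<phi> \<longrightarrow>
     (\<integral>x. u x * partial i \<phi> x \<partial>lebesgue_on D) = - (\<integral>x. (G x $ i) * \<phi> x \<partial>lebesgue_on D))"

text \<open>
  \<open>boundary_trace D u G w\<close>: \<open>w\<close> is the boundary trace of \<open>u \<in> H\<^sup>1(D)\<close> with gradient \<open>G\<close>, the
  trace operator being the continuous extension to \<open>H\<^sup>1(D)\<close> of the restriction to \<open>\<partial>D\<close> of
  smooth functions.
\<close>

definition boundary_trace ::
    "(real^'n::finite) set \<Rightarrow> (real^'n \<Rightarrow> complex) \<Rightarrow> (real^'n \<Rightarrow> complex^'n) \<Rightarrow> (real^'n \<Rightarrow> complex) \<Rightarrow> bool"
  where
  "boundary_trace D u G w \<longleftrightarrow> w \<in> L2 (surface D) \<and> (\<exists>\<phi>::nat \<Rightarrow> real^'n \<Rightarrow> complex.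
     (\<forall>m. smooth (\<phi> m)) \<and>
     (\<lambda>m. L2_norm (lebesgue_on D) (\<phi> m - u)) \<longlonglongrightarrow> 0 \<and>
     (\<lambda>m. L2_norm (lebesgue_on D) (cgrad (\<phi> m) - G)) \<longlonglongrightarrow> 0 \<and>
     (\<lambda>m. L2_norm (surface D) (\<phi> m - w)) \<longlonglongrightarrow> 0)"

text \<open>
  A function \<open>u \<in> H\<^sup>1(D)\<close> is carried around together with its weak gradient and its boundary trace,
  as a triple \<open>(u, \<nabla>u, u|\<^bsub>\<partial>D\<^esub>)\<close>.  On a convex polygonal domain every element of \<open>H\<^sup>1(D)\<close> has a
  gradient and a trace, and both are determined by \<open>u\<close> up to null sets, so these triples (up to null
  sets) correspond exactly to the elements of \<open>H\<^sup>1(D)\<close>.  The vector space operations on triples are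
  the pointwise ones.
\<close>

type_synonym 'n h1 = "(real^'n \<Rightarrow> complex) \<times> (real^'n \<Rightarrow> complex^'n) \<times> (real^'n \<Rightarrow> complex)"

definition val :: "'n::finite h1 \<Rightarrow> real^'n \<Rightarrow> complex" where
  "val u = fst u"

definition grad :: "'n::finite h1 \<Rightarrow> real^'n \<Rightarrow> complex^'n" where
  "grad u = fst (snd u)"

definition bdry :: "'n::finite h1 \<Rightarrow> real^'n \<Rightarrow> complex" where
  "bdry u = snd (snd u)"

definition h1_scale :: "real \<Rightarrow> 'n::finite h1 \<Rightarrow> 'n h1" where
  "h1_scale c u = ((\<lambda>x. c *\<^sub>R val u x), (\<lambda>x. c *\<^sub>R grad u x), (\<lambda>x. c *\<^sub>R bdry u x))"

definition H1 :: "(real^'n::finite) set \<Rightarrow> 'n h1 set" where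
  "H1 D = {u. val u \<in> L2 (lebesgue_on D) \<and> grad u \<in> L2 (lebesgue_on D) \<and>
     weak_gradient D (val u) (grad u) \<and> boundary_trace D (val u) (grad u) (bdry u)}"

definition H1_norm :: "(real^'n::finite) set \<Rightarrow> 'n h1 \<Rightarrow> real" where
  "H1_norm D u = sqrt ((L2_norm (lebesgue_on D) (val u))\<^sup>2 + (L2_norm (lebesgue_on D) (grad u))\<^sup>2)"

text \<open>
  \<open>gradient_trace D u H\<close>: \<open>H\<close> is the restriction of \<open>\<nabla>u\<close> to \<open>\<partial>D\<close>.  This requires more than
  \<open>u \<in> H\<^sup>1(D)\<close>; it is defined by closing \<open>\<phi> \<mapsto> \<nabla>\<phi>|\<^bsub>\<partial>D\<^esub>\<close> on smooth functions with respect to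
  convergence of \<open>\<phi>\<close> in \<open>H\<^sup>1(D)\<close> and of \<open>\<Delta>\<phi>\<close> in \<open>L\<^sup>2(D)\<close> (\<open>l\<close> is then the weak Laplacian of \<open>u\<close>).
  Convergence in \<open>H\<^sup>1(D)\<close> alone would not determine the normal component of \<open>H\<close>.
\<close>

definition gradient_trace ::
    "(real^'n::finite) set \<Rightarrow> 'n h1 \<Rightarrow> (real^'n \<Rightarrow> complex^'n) \<Rightarrow> bool" where
  "gradient_trace D u H \<longleftrightarrow> H \<in> L2 (surface D) \<and> (\<exists>(\<phi>::nat \<Rightarrow> real^'n \<Rightarrow> complex) l.
     l \<in> L2 (lebesgue_on D) \<and> (\<forall>m. smooth (\<phi> m)) \<and>
     (\<lambda>m. L2_norm (lebesgue_on D) (\<phi> m - val u)) \<longlonglongrightarrow> 0 \<and>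
     (\<lambda>m. L2_norm (lebesgue_on D) (cgrad (\<phi> m) - grad u)) \<longlonglongrightarrow> 0 \<and>
     (\<lambda>m. L2_norm (lebesgue_on D) (laplacian (\<phi> m) - l)) \<longlonglongrightarrow> 0 \<and>
     (\<lambda>m. L2_norm (surface D) (cgrad (\<phi> m) - H)) \<longlonglongrightarrow> 0)"


section \<open>Bochner spaces \<open>L\<^sup>2(\<Omega>, X)\<close>\<close>

text \<open>
  \<open>X\<close> is given as a set with a seminorm \<open>N\<close>; strong measurability means being a pointwise limit of
  \<open>X\<close>-valued simple functions.
\<close>

definition bochner_L2 ::
    "'w measure \<Rightarrow> 'v::ab_group_add set \<Rightarrow> ('v \<Rightarrow> real) \<Rightarrow> ('w \<Rightarrow> 'v) set" where
  "bochner_L2 P X N = {u. (\<forall>\<omega>\<in>space P. u \<omega> \<in> X) \<and>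
     (\<exists>s::nat \<Rightarrow> 'w \<Rightarrow> 'v. (\<forall>m. simple_function P (s m) \<and> (\<forall>\<omega>\<in>space P. s m \<omega> \<in> X)) \<and>
        (\<forall>\<omega>\<in>space P. (\<lambda>m. N (s m \<omega> - u \<omega>)) \<longlonglongrightarrow> 0)) \<and>
     (\<integral>\<^sup>+\<omega>. ennreal ((N (u \<omega>))\<^sup>2) \<partial>P) < \<infinity>}"

abbreviation L2_L2 ::
    "'w measure \<Rightarrow> 'a measure \<Rightarrow> ('w \<Rightarrow> 'a \<Rightarrow> 'b::real_normed_vector) set" where
  "L2_L2 P \<mu> \<equiv> bochner_L2 P (L2 \<mu>) (L2_norm \<mu>)"

abbreviation L2_Linf :: "'w measure \<Rightarrow> 'a measure \<Rightarrow> ('w \<Rightarrow> 'a \<Rightarrow> real) set" where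
  "L2_Linf P \<mu> \<equiv> bochner_L2 P (Linf \<mu>) (Linf_norm \<mu>)"

text \<open>
  The second condition (the trace component belongs to \<open>L\<^sup>2(\<Omega>, L\<^sup>2(\<partial>D))\<close>) follows from the first one
  by the trace theorem \<open>\<parallel>u\<parallel>\<^bsub>L\<^sup>2(\<partial>D)\<^esub> \<le> C \<parallel>u\<parallel>\<^bsub>H\<^sup>1(D)\<^esub>\<close>.
\<close>

definition L2_H1 :: "'w measure \<Rightarrow> (real^'n::finite) set \<Rightarrow> ('w \<Rightarrow> 'n h1) set" where
  "L2_H1 P D = {u \<in> bochner_L2 P (H1 D) (H1_norm D). (\<lambda>\<omega>. bdry (u \<omega>)) \<in> L2_L2 P (surface D)}"


section \<open>The Helmholtz problem\<close>

text \<open>Weak solution of \<open>-\<Delta>u - k\<^sup>2\<alpha>\<^sup>2u = f\<close> in \<open>D\<close>, \<open>\<partial>\<^sub>\<nu>u + \<i>k\<alpha>u = g\<close> on \<open>\<partial>D\<close>.\<close>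

definition weak_solution ::
    "'w measure \<Rightarrow> (real^'n::finite) set \<Rightarrow> real \<Rightarrow> ('w \<Rightarrow> real^'n \<Rightarrow> real) \<Rightarrow>
     ('w \<Rightarrow> real^'n \<Rightarrow> complex) \<Rightarrow> ('w \<Rightarrow> real^'n \<Rightarrow> complex) \<Rightarrow> ('w \<Rightarrow> 'n h1) \<Rightarrow> bool" where
  "weak_solution P D k \<alpha> f g u \<longleftrightarrow> u \<in> L2_H1 P D \<and> (\<forall>v\<in>L2_H1 P D.
     (\<integral>\<omega>. L2_inner_vec (lebesgue_on D) (grad (u \<omega>)) (grad (v \<omega>))
          - (of_real k)\<^sup>2 * L2_inner (lebesgue_on D) (\<lambda>x. (of_real (\<alpha> \<omega> x))\<^sup>2 * val (u \<omega>) x) (val (v \<omega>))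
          + \<i> * of_real k * L2_inner (surface D) (\<lambda>x. of_real (\<alpha> \<omega> x) * bdry (u \<omega>) x) (bdry (v \<omega>)) \<partial>P)
     = (\<integral>\<omega>. L2_inner (lebesgue_on D) (f \<omega>) (val (v \<omega>)) + L2_inner (surface D) (g \<omega>) (bdry (v \<omega>)) \<partial>P))"

definition gamma0 :: "nat \<Rightarrow> real \<Rightarrow> real" where
  "gamma0 d k = min 1 ((13 - 2 * real d) / (2 * (4 * real d - 7) + 25 * k))"

definition data_norm_sq ::
    "'w measure \<Rightarrow> (real^'n::finite) set \<Rightarrow> ('w \<Rightarrow> real^'n \<Rightarrow> complex) \<Rightarrow> ('w \<Rightarrow> real^'n \<Rightarrow> complex) \<Rightarrow> ennreal"
  where
  "data_norm_sq P D f g =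
     (\<integral>\<^sup>+\<omega>. ennreal ((L2_norm (lebesgue_on D) (f \<omega>))\<^sup>2 + (L2_norm (surface D) (g \<omega>))\<^sup>2) \<partial>P)"

text \<open>
  The wave-number-explicit a priori estimates.  The constant \<open>C\<^sub>0\<close> is uniform in \<open>k\<close>, \<open>\<epsilon>\<close>, the data
  and the solution.  \<open>H\<close> is \<open>\<nabla>u\<close> on \<open>\<partial>D\<close>; its existence is part of the first estimate.
\<close>

definition stability_constant ::
    "'w measure \<Rightarrow> (real^'n::finite) set \<Rightarrow> real \<Rightarrow> ('w \<Rightarrow> real^'n \<Rightarrow> real) \<Rightarrow> real \<Rightarrow> bool" where
  "stability_constant P D c\<^sub>0 \<eta> C\<^sub>0 \<longleftrightarrow> 0 < C\<^sub>0 \<and>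
    (\<forall>(k::real) \<epsilon> f g (u :: 'w \<Rightarrow> 'n h1).
       1 \<le> k \<longrightarrow> 0 \<le> \<epsilon> \<longrightarrow> \<epsilon> * (2 + \<epsilon>) < gamma0 CARD('n) k \<longrightarrow>
       f \<in> L2_L2 P (lebesgue_on D) \<longrightarrow> g \<in> L2_L2 P (surface D) \<longrightarrow>
       weak_solution P D k (\<lambda>\<omega> x. 1 + \<epsilon> * \<eta> \<omega> x) f g u \<longrightarrow>
       (\<exists>H \<in> L2_L2 P (surface D). (AE \<omega> in P. gradient_trace D (u \<omega>) (H \<omega>)) \<and>
          (\<integral>\<^sup>+\<omega>. ennreal ((L2_norm (lebesgue_on D) (val (u \<omega>)))\<^sup>2 + (L2_norm (surface D) (bdry (u \<omega>)))\<^sup>2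
                 + c\<^sub>0 * (L2_norm (surface D) (H \<omega>))\<^sup>2) \<partial>P)
          \<le> ennreal (C\<^sub>0 * (1 / k + 1 / k\<^sup>2)\<^sup>2) * data_norm_sq P D f g) \<and>
       (\<integral>\<^sup>+\<omega>. ennreal ((H1_norm D (u \<omega>))\<^sup>2) \<partial>P)
          \<le> ennreal (C\<^sub>0 * (1 + 1 / k\<^sup>2)\<^sup>2) * data_norm_sq P D f g)"

definition mode_functions ::
    "'w measure \<Rightarrow> (real^'n::finite) set \<Rightarrow> real \<Rightarrow> ('w \<Rightarrow> real^'n \<Rightarrow> real) \<Rightarrow>
     ('w \<Rightarrow> real^'n \<Rightarrow> complex) \<Rightarrow> (int \<Rightarrow> 'w \<Rightarrow> 'n h1) \<Rightarrow> bool" where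
  "mode_functions P D k \<eta> f u \<longleftrightarrow> u (-1) = 0 \<and>
     (\<forall>n\<ge>0. weak_solution P D k (\<lambda>\<omega> x. 1)
        (if n = 0 then f
         else (\<lambda>\<omega> x. 2 * (of_real k)\<^sup>2 * of_real (\<eta> \<omega> x) * val (u (n - 1) \<omega>) x
                   + (of_real k)\<^sup>2 * (of_real (\<eta> \<omega> x))\<^sup>2 * val (u (n - 2) \<omega>) x))
        (\<lambda>\<omega> x. - \<i> * of_real k * of_real (\<eta> \<omega> x) * bdry (u (n - 1) \<omega>) x)
        (u n))"

end

theory Submission
  imports Defs
begin

text \<open>
  The remainder \<open>u\<^sup>\<epsilon> - (\<Sum>n<N. \<epsilon>\<^sup>n u\<^sub>n)\<close> is again a weak solution of the perturbed Helmholtz problem: by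
  linearity all data cancel except terms in \<open>\<eta> u\<^sub>N\<^sub>-\<^sub>1\<close> and \<open>\<eta> u\<^sub>N\<^sub>-\<^sub>2\<close> carrying a factor \<open>\<epsilon>\<^sup>N\<close>, so the
  a priori \<open>H\<^sup>1\<close> estimate reduces the claim to the decay of the modes.  The a priori estimate with
  \<open>\<epsilon> = 0\<close> gives, for \<open>b\<^sub>n = \<epsilon>\<^sup>2\<^sup>n E(\<parallel>u\<^sub>n\<parallel>\<^sup>2 + \<parallel>u\<^sub>n|\<^bsub>\<partial>D\<^esub>\<parallel>\<^sup>2)\<close>, the recursion
  \<open>b\<^sub>n \<le> \<epsilon>\<^sup>2 C\<^sub>0 (1 + k)\<^sup>2 (8 b\<^sub>n\<^sub>-\<^sub>1 + 2 \<epsilon>\<^sup>2 b\<^sub>n\<^sub>-\<^sub>2) \<le> b\<^sub>n\<^sub>-\<^sub>1 / 2 + b\<^sub>n\<^sub>-\<^sub>2 / 8\<close>, whose solutions decay geometrically.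
\<close>

section \<open>\<open>L\<^sup>2\<close> and \<open>L\<^sup>\<infinity>\<close>\<close>

text \<open>What a mode feeds into its successors are its values in the domain and its trace, never
  its gradient. The first a priori estimate bounds exactly these two parts, so the recursion closes
  in them, and the \<open>H\<^sup>1\<close> estimate is applied only once, to the remainder and at
  the actual \<epsilon>.

  The hypothesis on \<sigma> is tuned to this recursion: squared sources carry \<open>k ^ 4\<close>,
  the estimate carries \<open>(1 / k + 1 / k\<^sup>2)\<^sup>2\<close>, and together they leave
  \<open>(1 + k)\<^sup>2\<close>. Squaring \<sigma> < 1 supplies a factor 1/16, and the resulting
  coefficients have sum 5/8, below 1.

  The bulk of the text has another cause. Vectors are functions, the norms are seminorms, and
  Bochner measurability means approximation by simple functions inside the space. The weak
  formulation is an identity of expectations, so data can be cancelled only after every pairing is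
  known to be integrable over \<Omega>, and the estimate applies only to data known to lie in the
  Bochner spaces. Multiplication by \<eta> is the delicate case: it is not Lipschitz, and square
  integrability of a product rests on the almost sure bound on \<eta>.\<close>

lemma L2_norm_nonneg [simp]: "0 \<le> L2_norm \<mu> f"
  by (simp add: L2_norm_def)

lemma L2_norm_square: "(L2_norm \<mu> f)\<^sup>2 = (\<integral>x. (norm (f x))\<^sup>2 \<partial>\<mu>)"
  by (simp add: L2_norm_def)

lemma L2_norm_minus_commute: "L2_norm \<mu> (f - g) = L2_norm \<mu> (g - f)"
  by (simp add: L2_norm_def norm_minus_commute)

lemma L2_measurable: "f \<in> L2 \<mu> \<Longrightarrow> f \<in> borel_measurable \<mu>"
  by (simp add: L2_def)

lemma L2_integrable: "f \<in> L2 \<mu> \<Longrightarrow> integrable \<mu> (\<lambda>x. (norm (f x))\<^sup>2)"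
  by (simp add: L2_def)

lemma norm_add_square_le: "(norm (a + b))\<^sup>2 \<le> 2 * (norm a)\<^sup>2 + 2 * (norm (b :: 'a::real_normed_vector))\<^sup>2"
proof -
  have "(norm (a + b))\<^sup>2 \<le> (norm a + norm b)\<^sup>2" by (intro power_mono norm_triangle_ineq) auto
  also have "\<dots> \<le> 2 * (norm a)\<^sup>2 + 2 * (norm b)\<^sup>2"
    using sum_squares_bound[of "norm a" "norm b"] by (simp add: power2_sum)
  finally show ?thesis .
qed

lemma L2_add:
  fixes f g :: "'a \<Rightarrow> 'b::{real_normed_vector, second_countable_topology}"
  assumes "f \<in> L2 \<mu>" "g \<in> L2 \<mu>"
  shows "f + g \<in> L2 \<mu>"
proof -
  note [measurable] = assms[THEN L2_measurable]
  have m: "(\<lambda>x. f x + g x) \<in> borel_measurable \<mu>" by measurable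
  have "integrable \<mu> (\<lambda>x. (norm (f x + g x))\<^sup>2)"
  proof (rule Bochner_Integration.integrable_bound)
    show "integrable \<mu> (\<lambda>x. 2 * (norm (f x))\<^sup>2 + 2 * (norm (g x))\<^sup>2)"
      using assms[THEN L2_integrable] by simp
  qed (auto intro!: AE_I2 order_trans[OF norm_add_square_le])
  with m show ?thesis by (simp add: L2_def plus_fun_def)
qed

text \<open>One lemma serves negation, scaling, conjugation and the coordinate projections of
  gradients.\<close>

lemma L2_bounded_linear:
  assumes T: "bounded_linear T" and f: "f \<in> L2 \<mu>"
  shows "(\<lambda>x. T (f x)) \<in> L2 \<mu>" "L2_norm \<mu> (\<lambda>x. T (f x)) \<le> onorm T * L2_norm \<mu> f"
proof -
  note [measurable] = f[THEN L2_measurable]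
  have [measurable]: "T \<in> borel_measurable borel"
    using T by (intro borel_measurable_continuous_onI linear_continuous_on)
  have le: "(norm (T (f x)))\<^sup>2 \<le> (onorm T)\<^sup>2 * (norm (f x))\<^sup>2" for x
    using onorm[OF T, of "f x"] by (metis norm_ge_zero power_mono power_mult_distrib)
  have i: "integrable \<mu> (\<lambda>x. (onorm T)\<^sup>2 * (norm (f x))\<^sup>2)"
    using L2_integrable[OF f] by simp
  have j: "integrable \<mu> (\<lambda>x. (norm (T (f x)))\<^sup>2)"
    by (rule Bochner_Integration.integrable_bound[OF i]) (use le in \<open>auto intro!: AE_I2\<close>)
  then show "(\<lambda>x. T (f x)) \<in> L2 \<mu>" by (simp add: L2_def)
  have "(L2_norm \<mu> (\<lambda>x. T (f x)))\<^sup>2 \<le> (onorm T * L2_norm \<mu> f)\<^sup>2"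
    unfolding power_mult_distrib L2_norm_square
    using integral_mono[OF j i le] by simp
  then show "L2_norm \<mu> (\<lambda>x. T (f x)) \<le> onorm T * L2_norm \<mu> f"
    by (rule power2_le_imp_le) (simp add: onorm_pos_le[OF T])
qed

lemma L2_minus:
  fixes f :: "'a \<Rightarrow> 'b::{real_normed_vector, second_countable_topology}"
  assumes "f \<in> L2 \<mu>"
  shows "- f \<in> L2 \<mu>"
  using L2_bounded_linear(1)[OF bounded_linear_minus[OF bounded_linear_ident] assms]
  by (simp add: fun_Compl_def)

lemma L2_diff:
  fixes f g :: "'a \<Rightarrow> 'b::{real_normed_vector, second_countable_topology}"
  assumes "f \<in> L2 \<mu>" "g \<in> L2 \<mu>"
  shows "f - g \<in> L2 \<mu>"
  using L2_add[OF assms(1) L2_minus[OF assms(2)]] by simp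

lemma L2_zero: "0 \<in> L2 \<mu>" "L2_norm \<mu> 0 = 0"
  by (simp_all add: L2_def L2_norm_def zero_fun_def)

lemma L2_finite_measure_bounded:
  fixes f :: "'a \<Rightarrow> 'b::{real_normed_vector, second_countable_topology}"
  assumes "finite_measure \<mu>" and [measurable]: "f \<in> borel_measurable \<mu>"
    and "\<And>x. x \<in> space \<mu> \<Longrightarrow> norm (f x) \<le> C"
  shows "f \<in> L2 \<mu>"
proof -
  interpret finite_measure \<mu> by fact
  have "integrable \<mu> (\<lambda>x. (norm (f x))\<^sup>2)"
    by (rule integrable_const_bound[where B = "C\<^sup>2"]) (auto intro!: AE_I2 power_mono assms(3))
  then show ?thesis by (simp add: L2_def)
qed

text \<open>Cauchy-Schwarz, taken from its form for integrals with values in [0,\<infinity>].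
  Integrability has to come first, from ab \<le> a^2 + b^2, so that the real and the extended
  integral are the same number.\<close>

lemma L2_norm_mult_integral:
  fixes f :: "'a \<Rightarrow> 'b::{real_normed_vector, second_countable_topology}"
    and g :: "'a \<Rightarrow> 'c::{real_normed_vector, second_countable_topology}"
  assumes "f \<in> L2 \<mu>" "g \<in> L2 \<mu>"
  shows "integrable \<mu> (\<lambda>x. norm (f x) * norm (g x))"
    "(\<integral>x. norm (f x) * norm (g x) \<partial>\<mu>) \<le> L2_norm \<mu> f * L2_norm \<mu> g"
proof -
  note [measurable] = assms[THEN L2_measurable]
  have le: "a * b \<le> a\<^sup>2 + b\<^sup>2" if "0 \<le> a" "0 \<le> b" for a b :: real
    using sum_squares_bound[of a b] zero_le_mult_iff[of a b] that by linarith
  show i: "integrable \<mu> (\<lambda>x. norm (f x) * norm (g x))"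
    by (rule Bochner_Integration.integrable_bound[where f = "\<lambda>x. (norm (f x))\<^sup>2 + (norm (g x))\<^sup>2"])
      (use assms[THEN L2_integrable] le in \<open>auto intro!: AE_I2\<close>)
  have "ennreal ((\<integral>x. norm (f x) * norm (g x) \<partial>\<mu>)\<^sup>2) = (\<integral>\<^sup>+x. ennreal (norm (f x)) * ennreal (norm (g x)) \<partial>\<mu>)\<^sup>2"
    by (simp add: nn_integral_eq_integral[OF i] ennreal_mult[symmetric] ennreal_power integral_nonneg_AE)
  also have "\<dots> \<le> (\<integral>\<^sup>+x. (ennreal (norm (f x)))\<^sup>2 \<partial>\<mu>) * (\<integral>\<^sup>+x. (ennreal (norm (g x)))\<^sup>2 \<partial>\<mu>)"
    by (rule Cauchy_Schwarz_nn_integral) measurable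
  also have "\<dots> = ennreal ((L2_norm \<mu> f * L2_norm \<mu> g)\<^sup>2)"
    by (simp add: ennreal_power nn_integral_eq_integral assms[THEN L2_integrable] L2_norm_square
        power_mult_distrib ennreal_mult integral_nonneg_AE)
  finally have "(\<integral>x. norm (f x) * norm (g x) \<partial>\<mu>)\<^sup>2 \<le> (L2_norm \<mu> f * L2_norm \<mu> g)\<^sup>2"
    by (simp add: ennreal_le_iff)
  then show "(\<integral>x. norm (f x) * norm (g x) \<partial>\<mu>) \<le> L2_norm \<mu> f * L2_norm \<mu> g"
    by (rule power2_le_imp_le) simp
qed

lemma L2_norm_triangle:
  fixes f g :: "'a \<Rightarrow> 'b::{real_normed_vector, second_countable_topology}"
  assumes "f \<in> L2 \<mu>" "g \<in> L2 \<mu>"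
  shows "L2_norm \<mu> (f + g) \<le> L2_norm \<mu> f + L2_norm \<mu> g"
proof -
  note i = assms[THEN L2_integrable] and fg = L2_norm_mult_integral[OF assms]
  have "(norm (f x + g x))\<^sup>2 \<le> (norm (f x))\<^sup>2 + (norm (g x))\<^sup>2 + 2 * (norm (f x) * norm (g x))" for x
    using power_mono[OF norm_triangle_ineq, of "f x" "g x" 2] by (simp add: power2_sum algebra_simps)
  then have "(L2_norm \<mu> (f + g))\<^sup>2 \<le> (\<integral>x. (norm (f x))\<^sup>2 + (norm (g x))\<^sup>2 + 2 * (norm (f x) * norm (g x)) \<partial>\<mu>)"
    unfolding L2_norm_square using L2_integrable[OF L2_add[OF assms]] i fg(1)
    by (intro integral_mono) auto
  also have "\<dots> = (L2_norm \<mu> f)\<^sup>2 + (L2_norm \<mu> g)\<^sup>2 + 2 * (\<integral>x. norm (f x) * norm (g x) \<partial>\<mu>)"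
    using i fg(1) by (simp add: L2_norm_square)
  also have "\<dots> \<le> (L2_norm \<mu> f + L2_norm \<mu> g)\<^sup>2" using fg(2) by (simp add: power2_sum)
  finally show ?thesis by (rule power2_le_imp_le) simp
qed

text \<open>\<open>Linf_norm\<close> passes through \<open>real_of_ereal\<close>, so the essential
  supremum must be shown finite. It is at most the bound C, and comparison with the function 0 keeps
  it above -\<infinity> unless the whole space is null, where the claim is vacuous.\<close>

lemma Linf_AE_le_norm:
  assumes "a \<in> Linf \<mu>"
  shows "AE x in \<mu>. \<bar>a x\<bar> \<le> Linf_norm \<mu> a"
proof (cases "emeasure \<mu> (space \<mu>) = 0")
  case True
  then have "AE x in \<mu>. False" by (intro AE_I[of _ _ "space \<mu>"]) auto
  then show ?thesis by eventually_elim simp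
next
  case False
  have [measurable]: "a \<in> borel_measurable \<mu>" using assms by (simp add: Linf_def)
  obtain C where C: "AE x in \<mu>. \<bar>a x\<bar> \<le> C" using assms by (auto simp: Linf_def)
  let ?e = "esssup \<mu> (\<lambda>x. ereal \<bar>a x\<bar>)"
  have "?e \<le> ereal C" using C by (intro esssup_I) auto
  moreover have "esssup \<mu> (\<lambda>x. 0 :: ereal) \<le> ?e" by (rule esssup_AE_mono) auto
  ultimately have "?e = ereal (Linf_norm \<mu> a)"
    using esssup_const[OF False, of "0::ereal"] by (cases ?e) (auto simp: Linf_norm_def)
  then show ?thesis using esssup_AE[of "\<lambda>x. ereal \<bar>a x\<bar>" \<mu>] by simp
qed

text \<open>On a null space the essential supremum is -\<infinity>, which
  \<open>real_of_ereal\<close> sends to 0. Otherwise a negative value would force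
  \<open>\<bar>a x\<bar>\<close> below 0 almost everywhere.\<close>

lemma Linf_norm_nonneg:
  assumes "a \<in> Linf \<mu>" shows "0 \<le> Linf_norm \<mu> a"
proof (cases "emeasure \<mu> (space \<mu>) = 0")
  case True
  then have "esssup \<mu> (\<lambda>x. ereal \<bar>a x\<bar>) = - \<infinity>" using assms
    by (intro esssup_zero_space) (auto simp: Linf_def)
  then show ?thesis by (simp add: Linf_norm_def)
next
  case False
  show ?thesis
  proof (rule ccontr)
    assume "\<not> ?thesis"
    then have "AE x in \<mu>. False" using Linf_AE_le_norm[OF assms] by (auto elim!: eventually_mono)
    then have "emeasure \<mu> (space \<mu>) = 0"
      using ae_filter_eq_bot_iff trivial_limit_def by blast
    with False show False by simp
  qed
qed

lemma Linf_diff: "a \<in> Linf \<mu> \<Longrightarrow> b \<in> Linf \<mu> \<Longrightarrow> a - b \<in> Linf \<mu>"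
proof -
  assume a: "a \<in> Linf \<mu>" and b: "b \<in> Linf \<mu>"
  then have [measurable]: "a \<in> borel_measurable \<mu>" "b \<in> borel_measurable \<mu>" by (auto simp: Linf_def)
  have "AE x in \<mu>. \<bar>a x - b x\<bar> \<le> Linf_norm \<mu> a + Linf_norm \<mu> b"
    using Linf_AE_le_norm[OF a] Linf_AE_le_norm[OF b] by eventually_elim linarith
  then show ?thesis by (auto simp: Linf_def fun_diff_def)
qed

text \<open>The bound C is kept free because it is used in two ways: with
  \<open>C = Linf_norm \<mu> a\<close> for the continuity of the product, and with
  \<open>C = 1\<close> for the almost sure bound on \<eta>.\<close>

lemma L2_mult_le:
  fixes w :: "'a \<Rightarrow> complex"
  assumes [measurable]: "a \<in> borel_measurable \<mu>" and a: "AE x in \<mu>. \<bar>a x\<bar> \<le> C" and C: "0 \<le> C"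
    and w: "w \<in> L2 \<mu>"
  shows "(\<lambda>x. of_real (a x) * w x) \<in> L2 \<mu>" "L2_norm \<mu> (\<lambda>x. of_real (a x) * w x) \<le> C * L2_norm \<mu> w"
proof -
  note [measurable] = w[THEN L2_measurable]
  have le: "AE x in \<mu>. (norm (of_real (a x) * w x))\<^sup>2 \<le> C\<^sup>2 * (norm (w x))\<^sup>2"
    using a
  proof eventually_elim
    case (elim x)
    then have "(a x)\<^sup>2 \<le> C\<^sup>2" by (metis abs_ge_zero power2_abs power_mono)
    then show ?case by (simp add: norm_mult power_mult_distrib mult_right_mono)
  qed
  have i: "integrable \<mu> (\<lambda>x. C\<^sup>2 * (norm (w x))\<^sup>2)"
    using L2_integrable[OF w] by simp
  have j: "integrable \<mu> (\<lambda>x. (norm (of_real (a x) * w x))\<^sup>2)"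
    by (rule Bochner_Integration.integrable_bound[OF i]) (use le in auto)
  then show "(\<lambda>x. of_real (a x) * w x) \<in> L2 \<mu>" by (simp add: L2_def)
  have "(L2_norm \<mu> (\<lambda>x. of_real (a x) * w x))\<^sup>2 \<le> (C * L2_norm \<mu> w)\<^sup>2"
    unfolding power_mult_distrib L2_norm_square
    using integral_mono_AE[OF j i le] by simp
  then show "L2_norm \<mu> (\<lambda>x. of_real (a x) * w x) \<le> C * L2_norm \<mu> w"
    by (rule power2_le_imp_le) (simp add: C)
qed

lemma Linf_mult_L2:
  fixes w :: "'a \<Rightarrow> complex"
  assumes "a \<in> Linf \<mu>" "w \<in> L2 \<mu>"
  shows "(\<lambda>x. of_real (a x) * w x) \<in> L2 \<mu>"
    "L2_norm \<mu> (\<lambda>x. of_real (a x) * w x) \<le> Linf_norm \<mu> a * L2_norm \<mu> w"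
  using L2_mult_le[OF _ Linf_AE_le_norm[OF assms(1)] Linf_norm_nonneg[OF assms(1)] assms(2)] assms(1)
  by (auto simp: Linf_def)

section \<open>The \<open>L2\<close> pairing, scalings and linear combinations\<close>

lemma L2_inner_integrable:
  assumes "f \<in> L2 \<mu>" "g \<in> L2 \<mu>"
  shows "integrable \<mu> (\<lambda>x. f x * cnj (g x))"
proof -
  note [measurable] = assms[THEN L2_measurable]
  have [measurable]: "(\<lambda>x. cnj (g x)) \<in> borel_measurable \<mu>"
    by (intro borel_measurable_continuous_on[where f = cnj] continuous_intros) simp
  show ?thesis
    by (rule Bochner_Integration.integrable_bound[OF L2_norm_mult_integral(1)[OF assms]])
      (auto simp: norm_mult intro!: AE_I2)
qed

lemma L2_inner_le:
  assumes "f \<in> L2 \<mu>" "g \<in> L2 \<mu>"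
  shows "norm (L2_inner \<mu> f g) \<le> L2_norm \<mu> f * L2_norm \<mu> g"
proof -
  have "norm (L2_inner \<mu> f g) \<le> (\<integral>x. norm (f x * cnj (g x)) \<partial>\<mu>)"
    unfolding L2_inner_def by (rule integral_norm_bound)
  also have "\<dots> \<le> L2_norm \<mu> f * L2_norm \<mu> g"
    using L2_norm_mult_integral(2)[OF assms] by (simp add: norm_mult)
  finally show ?thesis .
qed

lemma L2_inner_add_left:
  assumes "f \<in> L2 \<mu>" "f' \<in> L2 \<mu>" "g \<in> L2 \<mu>"
  shows "L2_inner \<mu> (\<lambda>x. f x + f' x) g = L2_inner \<mu> f g + L2_inner \<mu> f' g"
  unfolding L2_inner_def distrib_right using assms by (intro Bochner_Integration.integral_add L2_inner_integrable)

lemma L2_inner_diff_left: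
  assumes "f \<in> L2 \<mu>" "f' \<in> L2 \<mu>" "g \<in> L2 \<mu>"
  shows "L2_inner \<mu> (\<lambda>x. f x - f' x) g = L2_inner \<mu> f g - L2_inner \<mu> f' g"
  unfolding L2_inner_def left_diff_distrib using assms by (intro Bochner_Integration.integral_diff L2_inner_integrable)

lemma L2_inner_cmult_left: "L2_inner \<mu> (\<lambda>x. c * f x) g = c * L2_inner \<mu> f g"
  by (simp add: L2_inner_def mult.assoc)

lemma L2_inner_diff_right:
  assumes "f \<in> L2 \<mu>" "g \<in> L2 \<mu>" "g' \<in> L2 \<mu>"
  shows "L2_inner \<mu> f (\<lambda>x. g x - g' x) = L2_inner \<mu> f g - L2_inner \<mu> f g'"
  unfolding L2_inner_def complex_cnj_diff right_diff_distrib
  using assms by (intro Bochner_Integration.integral_diff L2_inner_integrable)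

lemma L2_norm_scaleR: "L2_norm \<mu> (\<lambda>x. c *\<^sub>R f x) = \<bar>c\<bar> * L2_norm \<mu> f"
  by (simp add: L2_norm_def power_mult_distrib real_sqrt_mult)

lemma L2_norm_cmult: "L2_norm \<mu> (\<lambda>x. c * f x) = norm c * L2_norm \<mu> f" for c :: complex
  by (simp add: L2_norm_def norm_mult power_mult_distrib real_sqrt_mult)

lemma L2_scaleR: "f \<in> L2 \<mu> \<Longrightarrow> (\<lambda>x. c *\<^sub>R f x) \<in> L2 \<mu>"
  by (rule L2_bounded_linear(1)[OF bounded_linear_scaleR_right])

lemma L2_add_scale:
  fixes f g :: "'a \<Rightarrow> 'b::{real_normed_vector, second_countable_topology}"
  shows "f \<in> L2 \<mu> \<Longrightarrow> g \<in> L2 \<mu> \<Longrightarrow> f + (\<lambda>x. c *\<^sub>R g x) \<in> L2 \<mu>"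
  by (intro L2_add L2_scaleR)

text \<open>The approximating sequences in \<open>boundary_trace\<close> survive linear combination;
  this is applied to values, gradients and traces alike.\<close>

lemma L2_add_scale_tendsto:
  fixes f g :: "'a \<Rightarrow> 'b::{real_normed_vector, second_countable_topology}"
  assumes "\<And>m. fs m \<in> L2 \<mu>" "\<And>m. gs m \<in> L2 \<mu>" "f \<in> L2 \<mu>" "g \<in> L2 \<mu>"
    and "(\<lambda>m. L2_norm \<mu> (fs m - f)) \<longlonglongrightarrow> 0" "(\<lambda>m. L2_norm \<mu> (gs m - g)) \<longlonglongrightarrow> 0"
  shows "(\<lambda>m. L2_norm \<mu> ((\<lambda>x. fs m x + c *\<^sub>R gs m x) - (f + (\<lambda>x. c *\<^sub>R g x)))) \<longlonglongrightarrow> 0"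
proof (rule Lim_null_comparison)
  show "(\<lambda>m. L2_norm \<mu> (fs m - f) + \<bar>c\<bar> * L2_norm \<mu> (gs m - g)) \<longlonglongrightarrow> 0"
    by (auto intro!: tendsto_eq_intros assms)
  have "L2_norm \<mu> ((\<lambda>x. fs m x + c *\<^sub>R gs m x) - (f + (\<lambda>x. c *\<^sub>R g x)))
      \<le> L2_norm \<mu> (fs m - f) + \<bar>c\<bar> * L2_norm \<mu> (gs m - g)" for m
  proof -
    have "(\<lambda>x. fs m x + c *\<^sub>R gs m x) - (f + (\<lambda>x. c *\<^sub>R g x)) = (fs m - f) + (\<lambda>x. c *\<^sub>R (gs m - g) x)"
      by (simp add: fun_eq_iff algebra_simps)
    then show ?thesis
      using L2_norm_triangle[OF L2_diff[OF assms(1,3)] L2_scaleR[OF L2_diff[OF assms(2,4)]], of m c m]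
      by (simp only: L2_norm_scaleR)
  qed
  then show "\<forall>\<^sub>F m in sequentially. norm (L2_norm \<mu> ((\<lambda>x. fs m x + c *\<^sub>R gs m x) - (f + (\<lambda>x. c *\<^sub>R g x))))
      \<le> L2_norm \<mu> (fs m - f) + \<bar>c\<bar> * L2_norm \<mu> (gs m - g)"
    by simp
qed

lemma L2_mult_integrable:
  fixes f g :: "'a \<Rightarrow> complex"
  assumes "f \<in> L2 \<mu>" "g \<in> L2 \<mu>"
  shows "integrable \<mu> (\<lambda>x. f x * g x)"
  using L2_inner_integrable[OF assms(1) L2_bounded_linear(1)[OF bounded_linear_cnj assms(2)]] by simp

lemma L2_norm_add_square_le:
  fixes f g :: "'a \<Rightarrow> 'b::{real_normed_vector, second_countable_topology}"
  assumes "f \<in> L2 \<mu>" "g \<in> L2 \<mu>"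
  shows "(L2_norm \<mu> (f + g))\<^sup>2 \<le> 2 * (L2_norm \<mu> f)\<^sup>2 + 2 * (L2_norm \<mu> g)\<^sup>2"
proof -
  have "(L2_norm \<mu> (f + g))\<^sup>2 \<le> (L2_norm \<mu> f + L2_norm \<mu> g)\<^sup>2"
    by (intro power_mono L2_norm_triangle assms) simp
  also have "\<dots> \<le> 2 * (L2_norm \<mu> f)\<^sup>2 + 2 * (L2_norm \<mu> g)\<^sup>2"
    using norm_add_square_le[of "L2_norm \<mu> f" "L2_norm \<mu> g"] by simp
  finally show ?thesis .
qed

section \<open>Bochner spaces\<close>

text \<open>Abstracts what \<open>L2\<close> and \<open>H1\<close> share. Their elements are
  functions or triples of functions that may have norm 0 without being 0, so membership and seminorm
  are carried as a set and a function instead of a normed type.\<close>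

locale seminormed_set =
  fixes X :: "'v::ab_group_add set" and N :: "'v \<Rightarrow> real"
  assumes diff_mem: "x \<in> X \<Longrightarrow> y \<in> X \<Longrightarrow> x - y \<in> X"
    and nonneg: "0 \<le> N x"
    and triangle: "x \<in> X \<Longrightarrow> y \<in> X \<Longrightarrow> N (x + y) \<le> N x + N y"
    and minus_commute: "N (x - y) = N (y - x)"
begin

lemma le_add_diff: "x \<in> X \<Longrightarrow> y \<in> X \<Longrightarrow> N x \<le> N y + N (x - y)"
  using triangle[of y "x - y"] diff_mem[of x y] by simp

lemma diff_abs_le: "x \<in> X \<Longrightarrow> y \<in> X \<Longrightarrow> \<bar>N x - N y\<bar> \<le> N (x - y)"
  using le_add_diff[of x y] le_add_diff[of y x] minus_commute[of x y] by linarith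

end

text \<open>The measurability half of \<open>bochner_L2\<close>, split off because for a product
  with \<eta> the two halves have different reasons: continuity of the product, and the almost sure
  bound.\<close>

definition strongly_measurable ::
    "'w measure \<Rightarrow> 'v::ab_group_add set \<Rightarrow> ('v \<Rightarrow> real) \<Rightarrow> ('w \<Rightarrow> 'v) \<Rightarrow> bool" where
  "strongly_measurable P X N u \<longleftrightarrow> (\<forall>\<omega>\<in>space P. u \<omega> \<in> X) \<and>
     (\<exists>s::nat \<Rightarrow> 'w \<Rightarrow> 'v. (\<forall>m. simple_function P (s m) \<and> (\<forall>\<omega>\<in>space P. s m \<omega> \<in> X)) \<and>
        (\<forall>\<omega>\<in>space P. (\<lambda>m. N (s m \<omega> - u \<omega>)) \<longlonglongrightarrow> 0))"

lemma bochner_L2_iff: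
  "u \<in> bochner_L2 P X N \<longleftrightarrow>
     strongly_measurable P X N u \<and> (\<integral>\<^sup>+\<omega>. ennreal ((N (u \<omega>))\<^sup>2) \<partial>P) < \<infinity>"
  by (auto simp: bochner_L2_def strongly_measurable_def)

lemma bochner_L2_strongly_measurable: "u \<in> bochner_L2 P X N \<Longrightarrow> strongly_measurable P X N u"
  by (simp add: bochner_L2_iff)

lemma bochner_L2_mem: "u \<in> bochner_L2 P X N \<Longrightarrow> \<omega> \<in> space P \<Longrightarrow> u \<omega> \<in> X"
  by (simp add: bochner_L2_def)

lemma bochner_L2_finite: "u \<in> bochner_L2 P X N \<Longrightarrow> (\<integral>\<^sup>+\<omega>. ennreal ((N (u \<omega>))\<^sup>2) \<partial>P) < \<infinity>"
  by (simp add: bochner_L2_def)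

text \<open>Apply B to the approximating simple functions: the result again takes finitely many
  values, and sequential continuity carries the pointwise limit over. Continuity is demanded only
  along sequences within X and Y, which suits products and pairings that are not Lipschitz.\<close>

lemma strongly_measurable_map2:
  assumes u: "strongly_measurable P X N u" and v: "strongly_measurable P Y M v"
    and mem: "\<And>x y. x \<in> X \<Longrightarrow> y \<in> Y \<Longrightarrow> B x y \<in> Z"
    and cont: "\<And>xs ys x y. (\<And>m. xs m \<in> X) \<Longrightarrow> (\<And>m. ys m \<in> Y) \<Longrightarrow> x \<in> X \<Longrightarrow> y \<in> Y \<Longrightarrow>
      (\<lambda>m::nat. N (xs m - x)) \<longlonglongrightarrow> 0 \<Longrightarrow> (\<lambda>m. M (ys m - y)) \<longlonglongrightarrow> 0 \<Longrightarrow>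
      (\<lambda>m. K (B (xs m) (ys m) - B x y)) \<longlonglongrightarrow> 0"
  shows "strongly_measurable P Z K (\<lambda>\<omega>. B (u \<omega>) (v \<omega>))"
proof -
  from u obtain s where s: "\<And>m. simple_function P (s m)" "\<And>m \<omega>. \<omega> \<in> space P \<Longrightarrow> s m \<omega> \<in> X"
    "\<And>\<omega>. \<omega> \<in> space P \<Longrightarrow> (\<lambda>m::nat. N (s m \<omega> - u \<omega>)) \<longlonglongrightarrow> 0" and u': "\<And>\<omega>. \<omega> \<in> space P \<Longrightarrow> u \<omega> \<in> X"
    unfolding strongly_measurable_def by blast
  from v obtain t where t: "\<And>m. simple_function P (t m)" "\<And>m \<omega>. \<omega> \<in> space P \<Longrightarrow> t m \<omega> \<in> Y"
    "\<And>\<omega>. \<omega> \<in> space P \<Longrightarrow> (\<lambda>m::nat. M (t m \<omega> - v \<omega>)) \<longlonglongrightarrow> 0" and v': "\<And>\<omega>. \<omega> \<in> space P \<Longrightarrow> v \<omega> \<in> Y"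
    unfolding strongly_measurable_def by blast
  show ?thesis
    unfolding strongly_measurable_def
  proof (intro conjI exI[of _ "\<lambda>m \<omega>. B (s m \<omega>) (t m \<omega>)"] ballI allI)
    show "simple_function P (\<lambda>\<omega>. B (s m \<omega>) (t m \<omega>))" for m
      by (rule simple_function_compose2[OF s(1) t(1)])
  qed (use s t u' v' in \<open>auto intro!: mem cont\<close>)
qed

text \<open>By the reverse triangle inequality the norms of the simple approximants converge
  pointwise.\<close>

lemma strongly_measurable_norm:
  assumes "seminormed_set X N" "strongly_measurable P X N u"
  shows "(\<lambda>\<omega>. N (u \<omega>)) \<in> borel_measurable P"
proof -
  interpret seminormed_set X N by fact
  from assms(2) obtain s where s: "\<And>m. simple_function P (s m)" "\<And>m \<omega>. \<omega> \<in> space P \<Longrightarrow> s m \<omega> \<in> X"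
    "\<And>\<omega>. \<omega> \<in> space P \<Longrightarrow> (\<lambda>m::nat. N (s m \<omega> - u \<omega>)) \<longlonglongrightarrow> 0" and u: "\<And>\<omega>. \<omega> \<in> space P \<Longrightarrow> u \<omega> \<in> X"
    unfolding strongly_measurable_def by blast
  show ?thesis
  proof (rule borel_measurable_LIMSEQ_metric)
    show "(\<lambda>\<omega>. N (s m \<omega>)) \<in> borel_measurable P" for m
      using simple_function_compose1[OF s(1)] by (intro borel_measurable_simple_function)
    show "(\<lambda>m. N (s m \<omega>)) \<longlonglongrightarrow> N (u \<omega>)" if "\<omega> \<in> space P" for \<omega>
    proof (rule LIM_zero_cancel, rule Lim_null_comparison[OF _ s(3)[OF that]])
      show "\<forall>\<^sub>F m in sequentially. norm (N (s m \<omega>) - N (u \<omega>)) \<le> N (s m \<omega> - u \<omega>)"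
        using diff_abs_le[OF s(2) u] that by simp
    qed
  qed
qed

text \<open>The way back to ordinary measurability, used for pairings as scalar functions of
  \<omega>.\<close>

lemma strongly_measurable_borel:
  fixes h :: "'w \<Rightarrow> 'b::real_normed_vector"
  assumes "strongly_measurable P UNIV norm h"
  shows "h \<in> borel_measurable P"
proof -
  from assms obtain s where s: "\<And>m. simple_function P (s m)"
    "\<And>\<omega>. \<omega> \<in> space P \<Longrightarrow> (\<lambda>m::nat. norm (s m \<omega> - h \<omega>)) \<longlonglongrightarrow> 0"
    unfolding strongly_measurable_def by blast
  show ?thesis
    by (rule borel_measurable_LIMSEQ_metric[where f = s])
      (use s in \<open>auto simp: tendsto_norm_zero_iff LIM_zero_iff intro: borel_measurable_simple_function\<close>)
qed

lemma bochner_L2_norm_measurable: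
  "seminormed_set X N \<Longrightarrow> u \<in> bochner_L2 P X N \<Longrightarrow> (\<lambda>\<omega>. N (u \<omega>)) \<in> borel_measurable P"
  by (simp add: bochner_L2_iff strongly_measurable_norm)

text \<open>The Lipschitz bound gives measurability and the linear growth bound gives square
  integrability. This covers linear combinations; bilinear maps such as multiplication by \<eta> are
  treated directly.\<close>

lemma bochner_L2_map2:
  assumes X: "seminormed_set X N" and Y: "seminormed_set Y M" and Z: "seminormed_set Z K"
    and u: "u \<in> bochner_L2 P X N" and v: "v \<in> bochner_L2 P Y M"
    and mem: "\<And>x y. x \<in> X \<Longrightarrow> y \<in> Y \<Longrightarrow> B x y \<in> Z"
    and lip: "\<And>x y x' y'. x \<in> X \<Longrightarrow> y \<in> Y \<Longrightarrow> x' \<in> X \<Longrightarrow> y' \<in> Y \<Longrightarrow>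
      K (B x y - B x' y') \<le> a * N (x - x') + b * M (y - y')"
    and bd: "\<And>x y. x \<in> X \<Longrightarrow> y \<in> Y \<Longrightarrow> K (B x y) \<le> a * N x + b * M y"
  shows "(\<lambda>\<omega>. B (u \<omega>) (v \<omega>)) \<in> bochner_L2 P Z K"
proof -
  have [measurable]: "(\<lambda>\<omega>. N (u \<omega>)) \<in> borel_measurable P" "(\<lambda>\<omega>. M (v \<omega>)) \<in> borel_measurable P"
    using X Y u v by (auto intro: bochner_L2_norm_measurable)
  have "strongly_measurable P Z K (\<lambda>\<omega>. B (u \<omega>) (v \<omega>))"
  proof (rule strongly_measurable_map2[OF bochner_L2_strongly_measurable[OF u] bochner_L2_strongly_measurable[OF v] mem])
    fix xs ys x y
    assume *: "\<And>m::nat. xs m \<in> X" "\<And>m. ys m \<in> Y" "x \<in> X" "y \<in> Y"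
      "(\<lambda>m. N (xs m - x)) \<longlonglongrightarrow> 0" "(\<lambda>m. M (ys m - y)) \<longlonglongrightarrow> 0"
    have "(\<lambda>m. a * N (xs m - x) + b * M (ys m - y)) \<longlonglongrightarrow> 0"
      by (auto intro!: tendsto_eq_intros *)
    then show "(\<lambda>m. K (B (xs m) (ys m) - B x y)) \<longlonglongrightarrow> 0"
      by (rule Lim_null_comparison[rotated]) (use lip * seminormed_set.nonneg[OF Z] in auto)
  qed
  moreover have "(\<integral>\<^sup>+\<omega>. ennreal ((K (B (u \<omega>) (v \<omega>)))\<^sup>2) \<partial>P) < \<infinity>"
  proof -
    have le: "(K (B (u \<omega>) (v \<omega>)))\<^sup>2 \<le> 2 * a\<^sup>2 * (N (u \<omega>))\<^sup>2 + 2 * b\<^sup>2 * (M (v \<omega>))\<^sup>2" if "\<omega> \<in> space P" for \<omega>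
    proof -
      have "(K (B (u \<omega>) (v \<omega>)))\<^sup>2 \<le> (a * N (u \<omega>) + b * M (v \<omega>))\<^sup>2"
        using bd bochner_L2_mem[OF u that] bochner_L2_mem[OF v that] seminormed_set.nonneg[OF Z]
        by (intro power_mono) auto
      also have "\<dots> \<le> (\<bar>a * N (u \<omega>) + b * M (v \<omega>)\<bar>)\<^sup>2" by simp
      also have "\<dots> \<le> 2 * a\<^sup>2 * (N (u \<omega>))\<^sup>2 + 2 * b\<^sup>2 * (M (v \<omega>))\<^sup>2"
        using norm_add_square_le[of "a * N (u \<omega>)" "b * M (v \<omega>)"] by (simp add: power_mult_distrib algebra_simps)
      finally show ?thesis .
    qed
    have "(\<integral>\<^sup>+\<omega>. ennreal ((K (B (u \<omega>) (v \<omega>)))\<^sup>2) \<partial>P)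
      \<le> (\<integral>\<^sup>+\<omega>. ennreal (2 * a\<^sup>2) * ennreal ((N (u \<omega>))\<^sup>2) + ennreal (2 * b\<^sup>2) * ennreal ((M (v \<omega>))\<^sup>2) \<partial>P)"
      by (intro nn_integral_mono)
        (use le in \<open>auto simp: ennreal_mult[symmetric] ennreal_plus[symmetric] simp del: ennreal_plus\<close>)
    also have "\<dots> = ennreal (2 * a\<^sup>2) * (\<integral>\<^sup>+\<omega>. ennreal ((N (u \<omega>))\<^sup>2) \<partial>P)
      + ennreal (2 * b\<^sup>2) * (\<integral>\<^sup>+\<omega>. ennreal ((M (v \<omega>))\<^sup>2) \<partial>P)"
      by (simp add: nn_integral_add nn_integral_cmult)
    also have "\<dots> < \<infinity>"
      using bochner_L2_finite[OF u] bochner_L2_finite[OF v] by (auto simp: ennreal_mult_less_top)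
    finally show ?thesis .
  qed
  ultimately show ?thesis by (simp add: bochner_L2_iff)
qed

lemma bochner_L2_map:
  assumes X: "seminormed_set X N" and Z: "seminormed_set Z K" and u: "u \<in> bochner_L2 P X N"
    and "\<And>x. x \<in> X \<Longrightarrow> T x \<in> Z"
    and "\<And>x x'. x \<in> X \<Longrightarrow> x' \<in> X \<Longrightarrow> K (T x - T x') \<le> a * N (x - x')"
    and "\<And>x. x \<in> X \<Longrightarrow> K (T x) \<le> a * N x"
  shows "(\<lambda>\<omega>. T (u \<omega>)) \<in> bochner_L2 P Z K"
  by (rule bochner_L2_map2[OF X X Z u u, where a = a and b = 0]) (use assms in auto)

section \<open>Operations on square integrable random \<open>L2\<close> functions\<close>

lemma seminormed_L2:
  "seminormed_set (L2 \<mu> :: ('a \<Rightarrow> 'b::{real_normed_vector, second_countable_topology}) set) (L2_norm \<mu>)"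
  by standard (auto intro: L2_diff L2_norm_triangle L2_norm_minus_commute)

lemma L2_L2_add:
  fixes f g :: "'w \<Rightarrow> 'a \<Rightarrow> 'b::{real_normed_vector, second_countable_topology}"
  assumes "f \<in> L2_L2 P \<mu>" "g \<in> L2_L2 P \<mu>"
  shows "(\<lambda>\<omega> x. f \<omega> x + g \<omega> x) \<in> L2_L2 P \<mu>"
proof -
  have "(\<lambda>\<omega>. f \<omega> + g \<omega>) \<in> L2_L2 P \<mu>"
  proof (rule bochner_L2_map2[OF seminormed_L2 seminormed_L2 seminormed_L2 assms, where a = 1 and b = 1 and B = "(+)"])
    fix x y x' y' :: "'a \<Rightarrow> 'b"
    assume "x \<in> L2 \<mu>" "y \<in> L2 \<mu>" "x' \<in> L2 \<mu>" "y' \<in> L2 \<mu>"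
    then show "L2_norm \<mu> (x + y - (x' + y')) \<le> 1 * L2_norm \<mu> (x - x') + 1 * L2_norm \<mu> (y - y')"
      using L2_norm_triangle[OF L2_diff L2_diff, of x \<mu> x' y y'] by (simp only: add_diff_add mult_1)
  qed (auto intro: L2_add L2_norm_triangle)
  then show ?thesis by (simp add: plus_fun_def)
qed

lemma L2_L2_bounded_linear:
  fixes f :: "'w \<Rightarrow> 'a \<Rightarrow> 'b::{real_normed_vector, second_countable_topology}"
    and T :: "'b \<Rightarrow> 'c::{real_normed_vector, second_countable_topology}"
  assumes T: "bounded_linear T" and f: "f \<in> L2_L2 P \<mu>"
  shows "(\<lambda>\<omega> x. T (f \<omega> x)) \<in> L2_L2 P \<mu>"
proof (rule bochner_L2_map[OF seminormed_L2 seminormed_L2 f, where a = "onorm T"])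
  interpret T: bounded_linear T by fact
  show "L2_norm \<mu> ((\<lambda>x. T (g x)) - (\<lambda>x. T (h x))) \<le> onorm T * L2_norm \<mu> (g - h)"
    if "g \<in> L2 \<mu>" "h \<in> L2 \<mu>" for g h
    using L2_bounded_linear(2)[OF T L2_diff[OF that]] by (simp add: T.diff fun_diff_def)
qed (use L2_bounded_linear[OF T] in auto)

lemma L2_L2_cmult:
  fixes f :: "'w \<Rightarrow> 'a \<Rightarrow> complex"
  assumes "f \<in> L2_L2 P \<mu>"
  shows "(\<lambda>\<omega> x. c * f \<omega> x) \<in> L2_L2 P \<mu>"
  by (rule L2_L2_bounded_linear[OF bounded_linear_mult_right assms])

lemma L2_L2_zero: "(\<lambda>\<omega> x. 0 :: 'b::real_normed_vector) \<in> L2_L2 P \<mu>"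
  unfolding zero_fun_def[symmetric] bochner_L2_def
  by (auto simp: L2_zero intro!: exI[of _ "\<lambda>_ _. 0"])

text \<open>The product of two elements that are square integrable in \<omega> need only be
  integrable, so square integrability is drawn from the almost sure bound 1. Measurability comes
  from the splitting of \<open>bs fs - b f\<close> into
  \<open>(bs - b) fs + b (fs - f)\<close>.\<close>

lemma L2_L2_mult:
  fixes w :: "'w \<Rightarrow> 'a \<Rightarrow> complex"
  assumes a: "a \<in> L2_Linf P \<mu>" and bd: "AE \<omega> in P. AE x in \<mu>. \<bar>a \<omega> x\<bar> \<le> 1" and w: "w \<in> L2_L2 P \<mu>"
  shows "(\<lambda>\<omega> x. of_real (a \<omega> x) * w \<omega> x) \<in> L2_L2 P \<mu>"
    "AE \<omega> in P. L2_norm \<mu> (\<lambda>x. of_real (a \<omega> x) * w \<omega> x) \<le> L2_norm \<mu> (w \<omega>)"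
proof -
  define B :: "('a \<Rightarrow> real) \<Rightarrow> ('a \<Rightarrow> complex) \<Rightarrow> 'a \<Rightarrow> complex" where "B b f = (\<lambda>x. of_real (b x) * f x)" for b f
  have sm: "strongly_measurable P (L2 \<mu>) (L2_norm \<mu>) (\<lambda>\<omega>. B (a \<omega>) (w \<omega>))"
  proof (rule strongly_measurable_map2[OF bochner_L2_strongly_measurable[OF a] bochner_L2_strongly_measurable[OF w]])
    show "B b f \<in> L2 \<mu>" if "b \<in> Linf \<mu>" "f \<in> L2 \<mu>" for b f
      using Linf_mult_L2(1)[OF that] by (simp add: B_def)
    fix bs :: "nat \<Rightarrow> 'a \<Rightarrow> real" and fs :: "nat \<Rightarrow> 'a \<Rightarrow> complex" and b f
    assume *: "\<And>m::nat. bs m \<in> Linf \<mu>" "\<And>m. fs m \<in> L2 \<mu>" "b \<in> Linf \<mu>" "f \<in> L2 \<mu>"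
      "(\<lambda>m. Linf_norm \<mu> (bs m - b)) \<longlonglongrightarrow> 0" "(\<lambda>m. L2_norm \<mu> (fs m - f)) \<longlonglongrightarrow> 0"
    \<comment> \<open>The norm of \<open>fs m\<close> is replaced by that of f plus an error, so
      that the bound contains only fixed numbers and null sequences.\<close>
    have le: "L2_norm \<mu> (B (bs m) (fs m) - B b f)
        \<le> Linf_norm \<mu> (bs m - b) * (L2_norm \<mu> f + L2_norm \<mu> (fs m - f)) + Linf_norm \<mu> b * L2_norm \<mu> (fs m - f)" for m
    proof -
      have fm: "fs m - f \<in> L2 \<mu>" and bm: "bs m - b \<in> Linf \<mu>" using * by (auto intro: L2_diff Linf_diff)
      have "B (bs m) (fs m) - B b f = B (bs m - b) (fs m) + B b (fs m - f)"
        by (simp add: B_def fun_eq_iff algebra_simps)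
      then have "L2_norm \<mu> (B (bs m) (fs m) - B b f) \<le> L2_norm \<mu> (B (bs m - b) (fs m)) + L2_norm \<mu> (B b (fs m - f))"
        using L2_norm_triangle[of "B (bs m - b) (fs m)" \<mu> "B b (fs m - f)"]
          Linf_mult_L2(1)[OF bm *(2)[of m]] Linf_mult_L2(1)[OF *(3) fm] by (simp add: B_def)
      also have "\<dots> \<le> Linf_norm \<mu> (bs m - b) * L2_norm \<mu> (fs m) + Linf_norm \<mu> b * L2_norm \<mu> (fs m - f)"
        using Linf_mult_L2(2)[OF bm *(2)[of m]] Linf_mult_L2(2)[OF *(3) fm] by (simp add: B_def)
      also have "\<dots> \<le> Linf_norm \<mu> (bs m - b) * (L2_norm \<mu> f + L2_norm \<mu> (fs m - f)) + Linf_norm \<mu> b * L2_norm \<mu> (fs m - f)"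
        using seminormed_set.le_add_diff[OF seminormed_L2 *(2)[of m] *(4)] Linf_norm_nonneg[OF bm] Linf_norm_nonneg[OF *(3)]
          by (intro add_mono mult_left_mono) auto
      finally show ?thesis .
    qed
    have "(\<lambda>m. Linf_norm \<mu> (bs m - b) * (L2_norm \<mu> f + L2_norm \<mu> (fs m - f)) + Linf_norm \<mu> b * L2_norm \<mu> (fs m - f)) \<longlonglongrightarrow> 0"
      by (auto intro!: tendsto_eq_intros *)
    then show "(\<lambda>m. L2_norm \<mu> (B (bs m) (fs m) - B b f)) \<longlonglongrightarrow> 0"
      by (rule Lim_null_comparison[rotated]) (use le in auto)
  qed
  show AE: "AE \<omega> in P. L2_norm \<mu> (\<lambda>x. of_real (a \<omega> x) * w \<omega> x) \<le> L2_norm \<mu> (w \<omega>)"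
    using bd AE_space
  proof eventually_elim
    case (elim \<omega>)
    then show ?case
      using L2_mult_le(2)[OF _ elim(1) _ bochner_L2_mem[OF w]] bochner_L2_mem[OF a]
      by (auto simp: Linf_def)
  qed
  have "(\<integral>\<^sup>+\<omega>. ennreal ((L2_norm \<mu> (B (a \<omega>) (w \<omega>)))\<^sup>2) \<partial>P) \<le> (\<integral>\<^sup>+\<omega>. ennreal ((L2_norm \<mu> (w \<omega>))\<^sup>2) \<partial>P)"
    using AE by (intro nn_integral_mono_AE) (auto elim!: eventually_mono intro!: ennreal_leI power_mono simp: B_def)
  then show "(\<lambda>\<omega> x. of_real (a \<omega> x) * w \<omega> x) \<in> L2_L2 P \<mu>"
    using sm bochner_L2_finite[OF w] by (auto simp: bochner_L2_iff B_def intro: le_less_trans)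
qed

text \<open>The pairing is sequentially continuous by the usual bilinear splitting, hence measurable
  in \<omega>; it is dominated by the sum of the two squared norms. This is what allows expectations
  of the weak formulation to be split.\<close>

lemma L2_L2_inner_integrable:
  fixes f g :: "'w \<Rightarrow> 'a \<Rightarrow> complex"
  assumes f: "f \<in> L2_L2 P \<mu>" and g: "g \<in> L2_L2 P \<mu>"
  shows "integrable P (\<lambda>\<omega>. L2_inner \<mu> (f \<omega>) (g \<omega>))"
proof -
  have [measurable]: "(\<lambda>\<omega>. L2_norm \<mu> (f \<omega>)) \<in> borel_measurable P" "(\<lambda>\<omega>. L2_norm \<mu> (g \<omega>)) \<in> borel_measurable P"
    using f g by (auto intro: bochner_L2_norm_measurable[OF seminormed_L2])
  have m: "(\<lambda>\<omega>. L2_inner \<mu> (f \<omega>) (g \<omega>)) \<in> borel_measurable P"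
  proof (rule strongly_measurable_borel, rule strongly_measurable_map2[OF bochner_L2_strongly_measurable[OF f] bochner_L2_strongly_measurable[OF g]])
    fix xs ys :: "nat \<Rightarrow> 'a \<Rightarrow> complex" and x y
    assume *: "\<And>m::nat. xs m \<in> L2 \<mu>" "\<And>m. ys m \<in> L2 \<mu>" "x \<in> L2 \<mu>" "y \<in> L2 \<mu>"
      "(\<lambda>m. L2_norm \<mu> (xs m - x)) \<longlonglongrightarrow> 0" "(\<lambda>m. L2_norm \<mu> (ys m - y)) \<longlonglongrightarrow> 0"
    have le: "norm (L2_inner \<mu> (xs m) (ys m) - L2_inner \<mu> x y)
        \<le> L2_norm \<mu> (xs m - x) * (L2_norm \<mu> y + L2_norm \<mu> (ys m - y)) + L2_norm \<mu> x * L2_norm \<mu> (ys m - y)" for m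
    proof -
      have xm: "xs m - x \<in> L2 \<mu>" and ym: "ys m - y \<in> L2 \<mu>" using * by (auto intro: L2_diff)
      have "L2_inner \<mu> (xs m) (ys m) - L2_inner \<mu> x y
          = L2_inner \<mu> (xs m - x) (ys m) + L2_inner \<mu> x (ys m - y)"
        using L2_inner_diff_left[OF *(1)[of m] *(3) *(2)[of m]] L2_inner_diff_right[OF *(3) *(2)[of m] *(4)]
        by (simp add: fun_diff_def)
      then have "norm (L2_inner \<mu> (xs m) (ys m) - L2_inner \<mu> x y)
          \<le> norm (L2_inner \<mu> (xs m - x) (ys m)) + norm (L2_inner \<mu> x (ys m - y))"
        using norm_triangle_ineq by metis
      also have "\<dots> \<le> L2_norm \<mu> (xs m - x) * L2_norm \<mu> (ys m) + L2_norm \<mu> x * L2_norm \<mu> (ys m - y)"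
        by (intro add_mono L2_inner_le xm ym *)
      also have "\<dots> \<le> L2_norm \<mu> (xs m - x) * (L2_norm \<mu> y + L2_norm \<mu> (ys m - y)) + L2_norm \<mu> x * L2_norm \<mu> (ys m - y)"
        using seminormed_set.le_add_diff[OF seminormed_L2 *(2)[of m] *(4)]
        by (intro add_mono mult_left_mono) auto
      finally show ?thesis .
    qed
    have "(\<lambda>m. L2_norm \<mu> (xs m - x) * (L2_norm \<mu> y + L2_norm \<mu> (ys m - y)) + L2_norm \<mu> x * L2_norm \<mu> (ys m - y)) \<longlonglongrightarrow> 0"
      by (auto intro!: tendsto_eq_intros *)
    then show "(\<lambda>m. norm (L2_inner \<mu> (xs m) (ys m) - L2_inner \<mu> x y)) \<longlonglongrightarrow> 0"
      by (rule Lim_null_comparison[rotated]) (use le in auto)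
  qed auto
  have "(\<integral>\<^sup>+\<omega>. ennreal (norm (L2_inner \<mu> (f \<omega>) (g \<omega>))) \<partial>P)
      \<le> (\<integral>\<^sup>+\<omega>. ennreal ((L2_norm \<mu> (f \<omega>))\<^sup>2) + ennreal ((L2_norm \<mu> (g \<omega>))\<^sup>2) \<partial>P)"
  proof (rule nn_integral_mono)
    fix \<omega> assume \<omega>: "\<omega> \<in> space P"
    let ?a = "L2_norm \<mu> (f \<omega>)" and ?b = "L2_norm \<mu> (g \<omega>)"
    have "norm (L2_inner \<mu> (f \<omega>) (g \<omega>)) \<le> ?a * ?b"
      by (rule L2_inner_le[OF bochner_L2_mem[OF f \<omega>] bochner_L2_mem[OF g \<omega>]])
    moreover have "0 \<le> ?a * ?b" by simp
    moreover have "2 * (?a * ?b) \<le> ?a\<^sup>2 + ?b\<^sup>2" using sum_squares_bound[of ?a ?b] by (simp add: mult.assoc)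
    ultimately have "norm (L2_inner \<mu> (f \<omega>) (g \<omega>)) \<le> ?a\<^sup>2 + ?b\<^sup>2" by linarith
    then show "ennreal (norm (L2_inner \<mu> (f \<omega>) (g \<omega>))) \<le> ennreal (?a\<^sup>2) + ennreal (?b\<^sup>2)"
      by (simp add: ennreal_plus[symmetric] del: ennreal_plus)
  qed
  also have "\<dots> = (\<integral>\<^sup>+\<omega>. ennreal ((L2_norm \<mu> (f \<omega>))\<^sup>2) \<partial>P) + (\<integral>\<^sup>+\<omega>. ennreal ((L2_norm \<mu> (g \<omega>))\<^sup>2) \<partial>P)"
    by (simp add: nn_integral_add)
  also have "\<dots> < \<infinity>" using bochner_L2_finite[OF f] bochner_L2_finite[OF g] by simp
  finally show ?thesis by (intro integrableI_bounded m)
qed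

section \<open>The space \<open>H\<^sup>1(D)\<close>\<close>

text \<open>The Borel subsets of the closed set \<open>frontier D\<close> already form a
  sigma-algebra, so the generated one adds nothing.\<close>

lemma sets_surface: "sets (surface D) = sets (restrict_space borel (frontier D))"
proof -
  have S: "{A \<in> sets borel. A \<subseteq> frontier D} = sets (restrict_space borel (frontier D))"
    by (auto simp: sets_restrict_space_iff)
  have "sets (surface D) = sigma_sets (frontier D) {A \<in> sets borel. A \<subseteq> frontier D}"
    unfolding surface_def by (rule sets_measure_of) auto
  also have "\<dots> = sets (restrict_space borel (frontier D))"
    unfolding S using sets.sigma_sets_eq[of "restrict_space borel (frontier D)"]
    by (simp add: space_restrict_space)
  finally show ?thesis .
qed

lemma space_surface: "space (surface D) = frontier D"
  using sets_eq_imp_space_eq[OF sets_surface] by (simp add: space_restrict_space)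

text \<open>Each facet contributes the volume of a prism of height 1 over a bounded set. Finiteness
  is needed so that continuous functions are square integrable on the boundary.\<close>

lemma finite_measure_surface:
  assumes D: "convex_polygonal_domain D"
  shows "finite_measure (surface D)"
proof
  have "bounded (closure D)" using D by (simp add: convex_polygonal_domain_def polytope_imp_bounded)
  then obtain R where R: "\<And>x. x \<in> closure D \<Longrightarrow> norm x \<le> R" by (auto simp: bounded_iff)
  have "emeasure lborel {x + s *\<^sub>R outward_normal D F | x s. x \<in> frontier D \<inter> F \<and> 0 \<le> s \<and> s \<le> 1} < \<infinity>"
    if F: "F facet_of closure D" for F
  proof (rule emeasure_bounded_finite)
    obtain b where b: "norm (outward_normal D F) = 1" using outward_normal_facet[OF D F] by metis
    show "bounded {x + s *\<^sub>R outward_normal D F | x s. x \<in> frontier D \<inter> F \<and> 0 \<le> s \<and> s \<le> 1}"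
      unfolding bounded_iff
    proof (intro exI[of _ "R + 1"] ballI, clarify)
      fix x and s :: real assume "x \<in> frontier D" "0 \<le> s" "s \<le> 1"
      then show "norm (x + s *\<^sub>R outward_normal D F) \<le> R + 1"
        using norm_triangle_ineq[of x "s *\<^sub>R outward_normal D F"] R[of x] b by (simp add: frontier_def)
    qed
  qed
  then have "emeasure (surface D) (frontier D) < \<infinity>"
    unfolding emeasure_surface[OF D borel_closed[OF frontier_closed] order_refl]
    \<comment> \<open>A sum over an infinite index set is 0 by convention, so both cases give a
      finite value.\<close>
    by (cases "finite {F. F facet_of closure D}") auto
  then show "emeasure (surface D) (space (surface D)) \<noteq> \<infinity>" by (simp add: space_surface)
qed

section \<open>Smooth functions and their integrability\<close>

lemma smooth_differentiable: "smooth \<phi> \<Longrightarrow> \<phi> differentiable (at x)"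
  and smooth_partial: "smooth \<phi> \<Longrightarrow> smooth (partial i \<phi>)"
  by (auto elim: smooth.cases)

lemma partial_add_scale:
  assumes "smooth \<phi>" "smooth \<psi>"
  shows "partial i (\<lambda>x. \<phi> x + c *\<^sub>R \<psi> x) = (\<lambda>x. partial i \<phi> x + c *\<^sub>R partial i \<psi> x)"
proof
  fix x
  have "((\<lambda>x. \<phi> x + c *\<^sub>R \<psi> x) has_derivative
      (\<lambda>h. frechet_derivative \<phi> (at x) h + c *\<^sub>R frechet_derivative \<psi> (at x) h)) (at x)"
    using assms[THEN smooth_differentiable, of x]
    by (intro has_derivative_add has_derivative_scaleR_right) (simp_all add: frechet_derivative_works)
  from frechet_derivative_at[OF this]
  show "partial i (\<lambda>x. \<phi> x + c *\<^sub>R \<psi> x) x = partial i \<phi> x + c *\<^sub>R partial i \<psi> x"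
    unfolding partial_def by metis
qed

text \<open>By coinduction. The invariant Q collects all combinations of two smooth functions with
  the same c; differentiating such a combination yields another one.\<close>

lemma smooth_add_scale:
  assumes "smooth \<phi>" "smooth \<psi>"
  shows "smooth (\<lambda>x. \<phi> x + c *\<^sub>R \<psi> x)"
proof -
  define Q where "Q \<theta> \<longleftrightarrow> (\<exists>\<phi> \<psi>. smooth \<phi> \<and> smooth \<psi> \<and> \<theta> = (\<lambda>x. \<phi> x + c *\<^sub>R \<psi> x))"
    for \<theta> :: "real^'a \<Rightarrow> complex"
  have "Q (\<lambda>x. \<phi> x + c *\<^sub>R \<psi> x)" using assms by (auto simp: Q_def)
  moreover have "(\<forall>x. \<theta> differentiable (at x)) \<and> (\<forall>i. Q (partial i \<theta>) \<or> smooth (partial i \<theta>))"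
    if "Q \<theta>" for \<theta>
  proof -
    from that obtain \<phi> \<psi> where *: "smooth \<phi>" "smooth \<psi>" "\<theta> = (\<lambda>x. \<phi> x + c *\<^sub>R \<psi> x)"
      by (auto simp: Q_def)
    have "\<forall>x. \<theta> differentiable (at x)"
      unfolding *(3) using smooth_differentiable[OF *(1)] smooth_differentiable[OF *(2)]
      by (auto intro!: derivative_intros)
    moreover have "Q (partial i \<theta>)" for i
      unfolding *(3) partial_add_scale[OF *(1,2)] using smooth_partial[OF *(1)] smooth_partial[OF *(2)]
      by (auto simp: Q_def)
    ultimately show ?thesis by blast
  qed
  ultimately show ?thesis using smooth.coinduct[of Q "\<lambda>x. \<phi> x + c *\<^sub>R \<psi> x"] by blast
qed

lemma cgrad_add_scale:
  assumes "smooth \<phi>" "smooth \<psi>"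
  shows "cgrad (\<lambda>x. \<phi> x + c *\<^sub>R \<psi> x) = (\<lambda>x. cgrad \<phi> x + c *\<^sub>R cgrad \<psi> x)"
  unfolding cgrad_def partial_add_scale[OF assms] by (simp add: fun_eq_iff vec_eq_iff)

lemma smooth_continuous: "smooth \<phi> \<Longrightarrow> continuous_on S \<phi>"
  by (meson continuous_at_imp_continuous_on differentiable_imp_continuous_within smooth_differentiable)

lemma smooth_cgrad_continuous: "smooth \<phi> \<Longrightarrow> continuous_on S (cgrad \<phi>)"
  unfolding cgrad_def by (intro continuous_on_vec_lambda smooth_continuous smooth_partial)

text \<open>The approximants and test functions are defined on the whole space, so they are bounded
  on the compact closure of the domain.\<close>

lemma continuous_L2_domain:
  fixes f :: "'a::euclidean_space \<Rightarrow> 'b::{real_normed_vector, second_countable_topology}"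
  assumes D: "open D" "bounded D" and f: "continuous_on UNIV f"
  shows "f \<in> L2 (lebesgue_on D)"
proof -
  have "bounded (f ` closure D)"
    using D by (intro compact_imp_bounded compact_continuous_image continuous_on_subset[OF f]) auto
  then obtain C where C: "\<And>x. x \<in> closure D \<Longrightarrow> norm (f x) \<le> C"
    by (auto simp: bounded_iff)
  show ?thesis
  proof (rule L2_finite_measure_bounded)
    show "finite_measure (lebesgue_on D)"
      using D by (intro finite_measure_lebesgue_on lmeasurable_open)
    have "f \<in> borel_measurable borel" using f by (rule borel_measurable_continuous_onI)
    then show "f \<in> borel_measurable (lebesgue_on D)"
      by (intro measurable_restrict_space1 measurable_completion) simp
    show "norm (f x) \<le> C" if "x \<in> space (lebesgue_on D)" for x
      using that C closure_subset by (auto simp: space_restrict_space)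
  qed
qed

lemma continuous_L2_surface:
  fixes f :: "'a::euclidean_space \<Rightarrow> 'b::{real_normed_vector, second_countable_topology}"
  assumes D: "convex_polygonal_domain D" and f: "continuous_on UNIV f"
  shows "f \<in> L2 (surface D)"
proof -
  have "compact (closure D)"
    using D unfolding convex_polygonal_domain_def by (blast intro: polytope_imp_compact)
  then have "bounded (f ` closure D)"
    by (intro compact_imp_bounded compact_continuous_image continuous_on_subset[OF f]) auto
  then obtain C where C: "\<And>x. x \<in> closure D \<Longrightarrow> norm (f x) \<le> C"
    by (auto simp: bounded_iff)
  show ?thesis
  proof (rule L2_finite_measure_bounded[OF finite_measure_surface[OF D]])
    have "f \<in> borel_measurable borel" using f by (rule borel_measurable_continuous_onI)
    then have "f \<in> borel_measurable (restrict_space borel (frontier D))" by (rule measurable_restrict_space1)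
    then show "f \<in> borel_measurable (surface D)" using sets_surface measurable_cong_sets by blast
    show "norm (f x) \<le> C" if "x \<in> space (surface D)" for x
      using that C by (auto simp: space_surface frontier_def)
  qed
qed

section \<open>Linear structure of triples and of \<open>H1\<close>\<close>

lemma val_simps [simp]:
  "val (u + v) = val u + val v" "val (u - v) = val u - val v" "val (h1_scale c u) = (\<lambda>x. c *\<^sub>R val u x)"
  "val 0 = 0"
  by (simp_all add: val_def h1_scale_def)

lemma grad_simps [simp]:
  "grad (u + v) = grad u + grad v" "grad (u - v) = grad u - grad v"
  "grad (h1_scale c u) = (\<lambda>x. c *\<^sub>R grad u x)" "grad 0 = 0"
  by (simp_all add: grad_def h1_scale_def)

lemma bdry_simps [simp]:
  "bdry (u + v) = bdry u + bdry v" "bdry (u - v) = bdry u - bdry v"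
  "bdry (h1_scale c u) = (\<lambda>x. c *\<^sub>R bdry u x)" "bdry 0 = 0"
  by (simp_all add: bdry_def h1_scale_def)

lemma h1_scale_minus: "h1_scale (- c) u = - h1_scale c u"
  by (simp add: h1_scale_def uminus_prod_def fun_Compl_def)

lemma h1_scale_one [simp]: "h1_scale 1 u = u"
  by (simp add: h1_scale_def val_def grad_def bdry_def)

lemma h1_scale_diff: "h1_scale c u - h1_scale c v = h1_scale c (u - v)"
  by (simp add: h1_scale_def val_def grad_def bdry_def minus_prod_def fun_diff_def scaleR_right_diff_distrib)

lemma weak_gradient_add_scale:
  assumes D: "open D" "bounded D"
    and mem: "u \<in> L2 (lebesgue_on D)" "v \<in> L2 (lebesgue_on D)" "G \<in> L2 (lebesgue_on D)" "H \<in> L2 (lebesgue_on D)"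
    and wg: "weak_gradient D u G" "weak_gradient D v H"
  shows "weak_gradient D (u + (\<lambda>x. c *\<^sub>R v x)) (G + (\<lambda>x. c *\<^sub>R H x))"
  unfolding weak_gradient_def
proof (intro allI impI)
  fix \<phi> i assume t: "test_function D \<phi>"
  then have sm: "smooth \<phi>" by (simp add: test_function_def)
  let ?M = "lebesgue_on D"
  have p: "\<phi> \<in> L2 ?M" "partial i \<phi> \<in> L2 ?M"
    using sm by (auto intro!: continuous_L2_domain[OF D] smooth_continuous smooth_partial)
  have "(\<lambda>x. K x $ i) \<in> L2 ?M" if "K \<in> L2 ?M" for K :: "real^'a \<Rightarrow> complex^'a"
    by (rule L2_bounded_linear(1)[OF bounded_linear_vec_nth that])
  note c = this[OF mem(3)] this[OF mem(4)]
  note i1 = L2_mult_integrable[OF mem(1) p(2)] L2_mult_integrable[OF mem(2) p(2)]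
    L2_mult_integrable[OF c(1) p(1)] L2_mult_integrable[OF c(2) p(1)]
  have "(\<integral>x. (u + (\<lambda>x. c *\<^sub>R v x)) x * partial i \<phi> x \<partial>?M)
      = (\<integral>x. u x * partial i \<phi> x \<partial>?M) + c *\<^sub>R (\<integral>x. v x * partial i \<phi> x \<partial>?M)"
    using i1 by (simp add: distrib_right)
  also have "\<dots> = - ((\<integral>x. G x $ i * \<phi> x \<partial>?M) + c *\<^sub>R (\<integral>x. H x $ i * \<phi> x \<partial>?M))"
    using wg t by (simp add: weak_gradient_def)
  also have "\<dots> = - (\<integral>x. (G + (\<lambda>x. c *\<^sub>R H x)) x $ i * \<phi> x \<partial>?M)"
    using i1 by (simp add: distrib_right)
  finally show "(\<integral>x. (u + (\<lambda>x. c *\<^sub>R v x)) x * partial i \<phi> x \<partial>?M)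
      = - (\<integral>x. (G + (\<lambda>x. c *\<^sub>R H x)) x $ i * \<phi> x \<partial>?M)" .
qed

text \<open>The trace is tied to values and gradient through one common smooth sequence. Combining
  the two sequences termwise approximates all three components of the combination at once.\<close>

lemma H1_add_scale:
  assumes D: "convex_polygonal_domain D" and u: "u \<in> H1 D" and v: "v \<in> H1 D"
  shows "u + h1_scale c v \<in> H1 D"
proof -
  let ?L = "lebesgue_on D" and ?S = "surface D"
  have D': "open D" "bounded D"
    using D by (auto simp: convex_polygonal_domain_def dest: polytope_imp_bounded intro: bounded_subset[OF _ closure_subset])
  have u': "val u \<in> L2 ?L" "grad u \<in> L2 ?L" "bdry u \<in> L2 ?S" "weak_gradient D (val u) (grad u)"
    and v': "val v \<in> L2 ?L" "grad v \<in> L2 ?L" "bdry v \<in> L2 ?S" "weak_gradient D (val v) (grad v)"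
    using u v by (auto simp: H1_def boundary_trace_def)
  obtain \<phi> where \<phi>: "\<And>m::nat. smooth (\<phi> m)" "(\<lambda>m. L2_norm ?L (\<phi> m - val u)) \<longlonglongrightarrow> 0"
     "(\<lambda>m. L2_norm ?L (cgrad (\<phi> m) - grad u)) \<longlonglongrightarrow> 0" "(\<lambda>m. L2_norm ?S (\<phi> m - bdry u)) \<longlonglongrightarrow> 0"
    using u unfolding H1_def boundary_trace_def by blast
  obtain \<psi> where \<psi>: "\<And>m::nat. smooth (\<psi> m)" "(\<lambda>m. L2_norm ?L (\<psi> m - val v)) \<longlonglongrightarrow> 0"
     "(\<lambda>m. L2_norm ?L (cgrad (\<psi> m) - grad v)) \<longlonglongrightarrow> 0" "(\<lambda>m. L2_norm ?S (\<psi> m - bdry v)) \<longlonglongrightarrow> 0"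
    using v unfolding H1_def boundary_trace_def by blast
  have sm: "\<theta> \<in> L2 ?L" "cgrad \<theta> \<in> L2 ?L" "\<theta> \<in> L2 ?S" if "smooth \<theta>" for \<theta>
    using that by (auto intro!: continuous_L2_domain[OF D'] continuous_L2_surface[OF D]
        smooth_continuous smooth_cgrad_continuous)
  have "boundary_trace D (val (u + h1_scale c v)) (grad (u + h1_scale c v)) (bdry (u + h1_scale c v))"
    unfolding boundary_trace_def val_simps grad_simps bdry_simps
  proof (intro conjI exI[of _ "\<lambda>m x. \<phi> m x + c *\<^sub>R \<psi> m x"] allI)
    show "bdry u + (\<lambda>x. c *\<^sub>R bdry v x) \<in> L2 ?S" by (rule L2_add_scale[OF u'(3) v'(3)])
    show "smooth (\<lambda>x. \<phi> m x + c *\<^sub>R \<psi> m x)" for m by (rule smooth_add_scale[OF \<phi>(1) \<psi>(1)])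
    show "(\<lambda>m. L2_norm ?L ((\<lambda>x. \<phi> m x + c *\<^sub>R \<psi> m x) - (val u + (\<lambda>x. c *\<^sub>R val v x)))) \<longlonglongrightarrow> 0"
      by (rule L2_add_scale_tendsto[OF sm(1)[OF \<phi>(1)] sm(1)[OF \<psi>(1)] u'(1) v'(1) \<phi>(2) \<psi>(2)])
    show "(\<lambda>m. L2_norm ?L (cgrad (\<lambda>x. \<phi> m x + c *\<^sub>R \<psi> m x) - (grad u + (\<lambda>x. c *\<^sub>R grad v x)))) \<longlonglongrightarrow> 0"
      unfolding cgrad_add_scale[OF \<phi>(1) \<psi>(1)]
      by (rule L2_add_scale_tendsto[OF sm(2)[OF \<phi>(1)] sm(2)[OF \<psi>(1)] u'(2) v'(2) \<phi>(3) \<psi>(3)])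
    show "(\<lambda>m. L2_norm ?S ((\<lambda>x. \<phi> m x + c *\<^sub>R \<psi> m x) - (bdry u + (\<lambda>x. c *\<^sub>R bdry v x)))) \<longlonglongrightarrow> 0"
      by (rule L2_add_scale_tendsto[OF sm(3)[OF \<phi>(1)] sm(3)[OF \<psi>(1)] u'(3) v'(3) \<phi>(4) \<psi>(4)])
  qed
  then show ?thesis
    using L2_add_scale[OF u'(1) v'(1)] L2_add_scale[OF u'(2) v'(2)]
      weak_gradient_add_scale[OF D' u'(1) v'(1) u'(2) v'(2) u'(4) v'(4)]
    by (simp add: H1_def)
qed

lemma H1_norm_nonneg [simp]: "0 \<le> H1_norm D u"
  by (simp add: H1_norm_def)

lemma H1_norm_scale: "H1_norm D (h1_scale c u) = \<bar>c\<bar> * H1_norm D u"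
proof -
  have "(\<bar>c\<bar> * a)\<^sup>2 + (\<bar>c\<bar> * b)\<^sup>2 = c\<^sup>2 * (a\<^sup>2 + b\<^sup>2)" for a b :: real
    by (simp add: power_mult_distrib distrib_left)
  then show ?thesis by (simp only: H1_norm_def val_simps grad_simps L2_norm_scaleR real_sqrt_mult real_sqrt_abs)
qed

lemma H1_norm_minus_commute: "H1_norm D (u - v) = H1_norm D (v - u)"
  by (simp only: H1_norm_def val_simps grad_simps L2_norm_minus_commute[of _ "val u"] L2_norm_minus_commute[of _ "grad u"])

lemma H1_diff:
  assumes "convex_polygonal_domain D" "u \<in> H1 D" "v \<in> H1 D"
  shows "u - v \<in> H1 D"
  using H1_add_scale[OF assms, of "-1"] by (simp add: h1_scale_minus)

lemma H1_norm_triangle: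
  assumes "u \<in> H1 D" "v \<in> H1 D"
  shows "H1_norm D (u + v) \<le> H1_norm D u + H1_norm D v"
proof -
  have "H1_norm D (u + v) \<le> sqrt ((L2_norm (lebesgue_on D) (val u) + L2_norm (lebesgue_on D) (val v))\<^sup>2
      + (L2_norm (lebesgue_on D) (grad u) + L2_norm (lebesgue_on D) (grad v))\<^sup>2)"
    unfolding H1_norm_def val_simps grad_simps using assms
    by (intro real_sqrt_le_mono add_mono power_mono L2_norm_triangle) (auto simp: H1_def)
  also have "\<dots> \<le> H1_norm D u + H1_norm D v"
    unfolding H1_norm_def by (rule real_sqrt_sum_squares_triangle_ineq)
  finally show ?thesis .
qed

lemma seminormed_H1: "convex_polygonal_domain D \<Longrightarrow> seminormed_set (H1 D) (H1_norm D)"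
  by standard
    (auto intro: H1_diff H1_norm_triangle H1_norm_minus_commute)

lemma val_le_H1_norm: "L2_norm (lebesgue_on D) (val u) \<le> H1_norm D u"
  and grad_le_H1_norm: "L2_norm (lebesgue_on D) (grad u) \<le> H1_norm D u"
  by (simp_all add: H1_norm_def real_le_rsqrt)

lemma L2_H1_add_scale:
  assumes D: "convex_polygonal_domain D" and u: "u \<in> L2_H1 P D" and v: "v \<in> L2_H1 P D"
  shows "(\<lambda>\<omega>. u \<omega> + h1_scale c (v \<omega>)) \<in> L2_H1 P D"
proof -
  note H = seminormed_H1[OF D]
  have b: "u \<in> bochner_L2 P (H1 D) (H1_norm D)" "v \<in> bochner_L2 P (H1 D) (H1_norm D)"
    "(\<lambda>\<omega>. bdry (u \<omega>)) \<in> L2_L2 P (surface D)" "(\<lambda>\<omega>. bdry (v \<omega>)) \<in> L2_L2 P (surface D)"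
    using u v by (auto simp: L2_H1_def)
  \<comment> \<open>The zero triple is obtained as a difference \<open>x - x\<close>, which makes
    plain scaling a case of \<open>H1_add_scale\<close>.\<close>
  have sc: "h1_scale c x \<in> H1 D" if "x \<in> H1 D" for x
    using H1_add_scale[OF D H1_diff[OF D that that] that, of c] by simp
  have le: "H1_norm D (x + h1_scale c y) \<le> H1_norm D x + \<bar>c\<bar> * H1_norm D y"
    if "x \<in> H1 D" "y \<in> H1 D" for x y
    using H1_norm_triangle[OF that(1) sc[OF that(2)]] by (simp add: H1_norm_scale)
  have "(\<lambda>\<omega>. u \<omega> + h1_scale c (v \<omega>)) \<in> bochner_L2 P (H1 D) (H1_norm D)"
  proof (rule bochner_L2_map2[OF H H H b(1,2), where a = 1 and b = "\<bar>c\<bar>"])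
    fix x y x' y' assume *: "x \<in> H1 D" "y \<in> H1 D" "x' \<in> H1 D" "y' \<in> H1 D"
    have "x + h1_scale c y - (x' + h1_scale c y') = (x - x') + h1_scale c (y - y')"
      by (simp only: add_diff_add h1_scale_diff)
    then show "H1_norm D (x + h1_scale c y - (x' + h1_scale c y'))
        \<le> 1 * H1_norm D (x - x') + \<bar>c\<bar> * H1_norm D (y - y')"
      using le[OF H1_diff[OF D *(1,3)] H1_diff[OF D *(2,4)]] by (simp only: mult_1)
  qed (use le H1_add_scale[OF D] in auto)
  moreover have "(\<lambda>\<omega>. bdry (u \<omega> + h1_scale c (v \<omega>))) \<in> L2_L2 P (surface D)"
    using L2_L2_add[OF b(3) L2_L2_bounded_linear[OF bounded_linear_scaleR_right b(4), of c]]
    by (simp add: plus_fun_def)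
  ultimately show ?thesis by (simp add: L2_H1_def)
qed

lemma L2_H1_val:
  assumes D: "convex_polygonal_domain D" and u: "u \<in> L2_H1 P D"
  shows "(\<lambda>\<omega>. val (u \<omega>)) \<in> L2_L2 P (lebesgue_on D)"
proof (rule bochner_L2_map[OF seminormed_H1[OF D] seminormed_L2, where a = 1])
  show "L2_norm (lebesgue_on D) (val x - val y) \<le> 1 * H1_norm D (x - y)" for x y
    using val_le_H1_norm[of D "x - y"] by simp
qed (use u in \<open>auto simp: L2_H1_def H1_def val_le_H1_norm\<close>)

lemma L2_H1_grad:
  assumes D: "convex_polygonal_domain D" and u: "u \<in> L2_H1 P D"
  shows "(\<lambda>\<omega>. grad (u \<omega>)) \<in> L2_L2 P (lebesgue_on D)"
proof (rule bochner_L2_map[OF seminormed_H1[OF D] seminormed_L2, where a = 1])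
  show "L2_norm (lebesgue_on D) (grad x - grad y) \<le> 1 * H1_norm D (x - y)" for x y
    using grad_le_H1_norm[of D "x - y"] by simp
qed (use u in \<open>auto simp: L2_H1_def H1_def grad_le_H1_norm\<close>)

lemma L2_H1_bdry: "u \<in> L2_H1 P D \<Longrightarrow> (\<lambda>\<omega>. bdry (u \<omega>)) \<in> L2_L2 P (surface D)"
  by (simp add: L2_H1_def)

section \<open>The sesquilinear form and its perturbation\<close>

text \<open>Reduces linearity and integrability of the gradient pairing to the scalar case.\<close>

lemma L2_inner_vec_eq_sum:
  fixes U V :: "'a \<Rightarrow> complex^'n::finite"
  assumes "U \<in> L2 \<mu>" "V \<in> L2 \<mu>"
  shows "L2_inner_vec \<mu> U V = (\<Sum>i\<in>UNIV. L2_inner \<mu> (\<lambda>x. U x $ i) (\<lambda>x. V x $ i))"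
  unfolding L2_inner_vec_def L2_inner_def
  using assms by (intro Bochner_Integration.integral_sum L2_inner_integrable L2_bounded_linear(1)[OF bounded_linear_vec_nth])

lemma L2_inner_vec_diff_scale_left:
  fixes U V W :: "'a \<Rightarrow> complex^'n::finite"
  assumes "U \<in> L2 \<mu>" "V \<in> L2 \<mu>" "W \<in> L2 \<mu>"
  shows "L2_inner_vec \<mu> (U - (\<lambda>x. c *\<^sub>R V x)) W = L2_inner_vec \<mu> U W - of_real c * L2_inner_vec \<mu> V W"
proof -
  have c: "(\<lambda>x. K x $ i) \<in> L2 \<mu>" if "K \<in> L2 \<mu>" for K :: "'a \<Rightarrow> complex^'n" and i
    by (rule L2_bounded_linear(1)[OF bounded_linear_vec_nth that])
  have "L2_inner \<mu> (\<lambda>x. (U - (\<lambda>x. c *\<^sub>R V x)) x $ i) (\<lambda>x. W x $ i)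
      = L2_inner \<mu> (\<lambda>x. U x $ i) (\<lambda>x. W x $ i) - of_real c * L2_inner \<mu> (\<lambda>x. V x $ i) (\<lambda>x. W x $ i)" for i
    using L2_inner_diff_left[OF c[OF assms(1)] L2_scaleR[OF c[OF assms(2)]] c[OF assms(3)], of i c i i]
    by (simp add: scaleR_conv_of_real[where 'a = complex] L2_inner_cmult_left)
  moreover have "U - (\<lambda>x. c *\<^sub>R V x) \<in> L2 \<mu>" by (intro L2_diff L2_scaleR assms)
  ultimately show ?thesis
    using assms by (simp add: L2_inner_vec_eq_sum sum_subtractf sum_distrib_left del: vector_minus_component vector_scaleR_component)
qed

lemma L2_L2_inner_vec_integrable:
  fixes U V :: "'w \<Rightarrow> 'a \<Rightarrow> complex^'n::finite"
  assumes "U \<in> L2_L2 P \<mu>" "V \<in> L2_L2 P \<mu>"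
  shows "integrable P (\<lambda>\<omega>. L2_inner_vec \<mu> (U \<omega>) (V \<omega>))"
proof -
  have "integrable P (\<lambda>\<omega>. \<Sum>i\<in>UNIV. L2_inner \<mu> (\<lambda>x. U \<omega> x $ i) (\<lambda>x. V \<omega> x $ i))"
    using assms by (intro Bochner_Integration.integrable_sum L2_L2_inner_integrable
        L2_L2_bounded_linear[OF bounded_linear_vec_nth])
  also have "?this \<longleftrightarrow> ?thesis"
    using bochner_L2_mem[OF assms(1)] bochner_L2_mem[OF assms(2)]
    by (intro Bochner_Integration.integrable_cong[OF refl]) (auto simp: L2_inner_vec_eq_sum)
  finally show ?thesis .
qed

text \<open>A single function \<eta> supplies interior and boundary values, seen through two
  measures. Both bounds are stated pointwise almost everywhere, so that one multiplication lemma
  serves the domain and the surface.\<close>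

locale random_medium =
  fixes P :: "'w measure" and D :: "(real^'n::finite) set" and \<eta> :: "'w \<Rightarrow> real^'n \<Rightarrow> real"
  assumes D: "convex_polygonal_domain D"
    and \<eta>_domain: "\<eta> \<in> L2_Linf P (lebesgue_on D)" "AE \<omega> in P. AE x in lebesgue_on D. \<bar>\<eta> \<omega> x\<bar> \<le> 1"
    and \<eta>_surface: "\<eta> \<in> L2_Linf P (surface D)" "AE \<omega> in P. AE x in surface D. \<bar>\<eta> \<omega> x\<bar> \<le> 1"
begin

lemmas mult_domain = L2_L2_mult[OF \<eta>_domain]
lemmas mult_surface = L2_L2_mult[OF \<eta>_surface]

abbreviation \<alpha> :: "real \<Rightarrow> 'w \<Rightarrow> real^'n \<Rightarrow> real" where
  "\<alpha> \<epsilon> \<equiv> (\<lambda>\<omega> x. 1 + \<epsilon> * \<eta> \<omega> x)"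

text \<open>\<open>quad \<epsilon> w = (\<alpha>\<^sup>2 - 1) w\<close>, grouped so that only multiplications by \<open>\<eta>\<close> occur.\<close>

definition quad :: "real \<Rightarrow> ('w \<Rightarrow> real^'n \<Rightarrow> complex) \<Rightarrow> 'w \<Rightarrow> real^'n \<Rightarrow> complex" where
  "quad \<epsilon> w = (\<lambda>\<omega> x. 2 * of_real \<epsilon> * (of_real (\<eta> \<omega> x) * w \<omega> x)
     + (of_real \<epsilon>)\<^sup>2 * (of_real (\<eta> \<omega> x) * (of_real (\<eta> \<omega> x) * w \<omega> x)))"

definition lin :: "real \<Rightarrow> ('w \<Rightarrow> real^'n \<Rightarrow> complex) \<Rightarrow> 'w \<Rightarrow> real^'n \<Rightarrow> complex" where
  "lin \<epsilon> w = (\<lambda>\<omega> x. of_real \<epsilon> * (of_real (\<eta> \<omega> x) * w \<omega> x))"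

lemma quad_mem: "w \<in> L2_L2 P (lebesgue_on D) \<Longrightarrow> quad \<epsilon> w \<in> L2_L2 P (lebesgue_on D)"
  unfolding quad_def by (intro L2_L2_add L2_L2_cmult mult_domain(1))

lemma lin_mem: "w \<in> L2_L2 P (surface D) \<Longrightarrow> lin \<epsilon> w \<in> L2_L2 P (surface D)"
  unfolding lin_def by (intro L2_L2_cmult mult_surface(1))

lemma alpha_square_mult: "(of_real (\<alpha> \<epsilon> \<omega> x))\<^sup>2 * w \<omega> x = w \<omega> x + quad \<epsilon> w \<omega> x"
  by (simp add: quad_def power2_eq_square algebra_simps)

lemma alpha_mult: "of_real (\<alpha> \<epsilon> \<omega> x) * w \<omega> x = w \<omega> x + lin \<epsilon> w \<omega> x"
  by (simp add: lin_def algebra_simps)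

definition form :: "real \<Rightarrow> real \<Rightarrow> ('w \<Rightarrow> 'n h1) \<Rightarrow> ('w \<Rightarrow> 'n h1) \<Rightarrow> 'w \<Rightarrow> complex" where
  "form k \<epsilon> u v \<omega> = L2_inner_vec (lebesgue_on D) (grad (u \<omega>)) (grad (v \<omega>))
     - (of_real k)\<^sup>2 * L2_inner (lebesgue_on D) (\<lambda>x. (of_real (\<alpha> \<epsilon> \<omega> x))\<^sup>2 * val (u \<omega>) x) (val (v \<omega>))
     + \<i> * of_real k * L2_inner (surface D) (\<lambda>x. of_real (\<alpha> \<epsilon> \<omega> x) * bdry (u \<omega>) x) (bdry (v \<omega>))"

definition load ::
    "('w \<Rightarrow> real^'n \<Rightarrow> complex) \<Rightarrow> ('w \<Rightarrow> real^'n \<Rightarrow> complex) \<Rightarrow> ('w \<Rightarrow> 'n h1) \<Rightarrow> 'w \<Rightarrow> complex" where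
  "load f g v \<omega> = L2_inner (lebesgue_on D) (f \<omega>) (val (v \<omega>)) + L2_inner (surface D) (g \<omega>) (bdry (v \<omega>))"

lemma weak_solution_iff:
  "weak_solution P D k (\<alpha> \<epsilon>) f g u \<longleftrightarrow>
     u \<in> L2_H1 P D \<and> (\<forall>v\<in>L2_H1 P D. (\<integral>\<omega>. form k \<epsilon> u v \<omega> \<partial>P) = (\<integral>\<omega>. load f g v \<omega> \<partial>P))"
  by (simp add: weak_solution_def form_def load_def)

lemmas val_mem = L2_H1_val[OF D]
lemmas grad_mem = L2_H1_grad[OF D]

lemma load_integrable:
  assumes "f \<in> L2_L2 P (lebesgue_on D)" "g \<in> L2_L2 P (surface D)" "v \<in> L2_H1 P D"
  shows "integrable P (load f g v)"
  unfolding load_def[abs_def] using assms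
  by (intro Bochner_Integration.integrable_add L2_L2_inner_integrable val_mem L2_H1_bdry)

lemma load_diff_cmult:
  assumes "f \<in> L2_L2 P (lebesgue_on D)" "g \<in> L2_L2 P (surface D)"
    and "f' \<in> L2_L2 P (lebesgue_on D)" "g' \<in> L2_L2 P (surface D)"
    and v: "v \<in> L2_H1 P D" and \<omega>: "\<omega> \<in> space P"
  shows "load (\<lambda>\<omega> x. f \<omega> x - c * f' \<omega> x) (\<lambda>\<omega> x. g \<omega> x - c * g' \<omega> x) v \<omega> = load f g v \<omega> - c * load f' g' v \<omega>"
proof -
  note m = assms(1-4)[THEN bochner_L2_mem, OF \<omega>] val_mem[OF v, THEN bochner_L2_mem, OF \<omega>]
    L2_H1_bdry[OF v, THEN bochner_L2_mem, OF \<omega>]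
    assms(3,4)[THEN L2_L2_cmult, THEN bochner_L2_mem, OF \<omega>]
  show ?thesis
    unfolding load_def
    by (simp add: m L2_inner_diff_left L2_inner_cmult_left algebra_simps)
qed

text \<open>Apart from the gradient pairing, every term of the form has the shape of
  \<open>load\<close> with data built from u. Linearity and integrability of the form are thus
  inherited from \<open>load\<close>.\<close>

lemma form_eq:
  assumes u: "u \<in> L2_H1 P D" and v: "v \<in> L2_H1 P D" and \<omega>: "\<omega> \<in> space P"
  shows "form k \<epsilon> u v \<omega> = L2_inner_vec (lebesgue_on D) (grad (u \<omega>)) (grad (v \<omega>))
     + load (\<lambda>\<omega> x. - (of_real k)\<^sup>2 * val (u \<omega>) x) (\<lambda>\<omega> x. \<i> * of_real k * bdry (u \<omega>) x) v \<omega>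
     + load (\<lambda>\<omega> x. - (of_real k)\<^sup>2 * quad \<epsilon> (\<lambda>\<omega>. val (u \<omega>)) \<omega> x)
         (\<lambda>\<omega> x. \<i> * of_real k * lin \<epsilon> (\<lambda>\<omega>. bdry (u \<omega>)) \<omega> x) v \<omega>"
proof -
  note m = val_mem[OF u, THEN bochner_L2_mem, OF \<omega>] L2_H1_bdry[OF u, THEN bochner_L2_mem, OF \<omega>]
    val_mem[OF v, THEN bochner_L2_mem, OF \<omega>] L2_H1_bdry[OF v, THEN bochner_L2_mem, OF \<omega>]
    quad_mem[OF val_mem[OF u], THEN bochner_L2_mem, OF \<omega>] lin_mem[OF L2_H1_bdry[OF u], THEN bochner_L2_mem, OF \<omega>]
  show ?thesis
    unfolding form_def load_def alpha_square_mult[where w = "\<lambda>\<omega>. val (u \<omega>)"] alpha_mult[where w = "\<lambda>\<omega>. bdry (u \<omega>)"]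
      L2_inner_cmult_left
    by (simp add: m L2_inner_add_left algebra_simps)
qed

lemma form_integrable:
  assumes u: "u \<in> L2_H1 P D" and v: "v \<in> L2_H1 P D"
  shows "integrable P (form k \<epsilon> u v)"
proof -
  have "integrable P (\<lambda>\<omega>. L2_inner_vec (lebesgue_on D) (grad (u \<omega>)) (grad (v \<omega>))
     + load (\<lambda>\<omega> x. - (of_real k)\<^sup>2 * val (u \<omega>) x) (\<lambda>\<omega> x. \<i> * of_real k * bdry (u \<omega>) x) v \<omega>
     + load (\<lambda>\<omega> x. - (of_real k)\<^sup>2 * quad \<epsilon> (\<lambda>\<omega>. val (u \<omega>)) \<omega> x)
         (\<lambda>\<omega> x. \<i> * of_real k * lin \<epsilon> (\<lambda>\<omega>. bdry (u \<omega>)) \<omega> x) v \<omega>)"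
    using assms by (intro Bochner_Integration.integrable_add L2_L2_inner_vec_integrable load_integrable
        L2_L2_cmult quad_mem lin_mem val_mem grad_mem L2_H1_bdry)
  also have "?this \<longleftrightarrow> ?thesis"
    by (intro Bochner_Integration.integrable_cong[OF refl]) (auto simp: form_eq[OF assms])
  finally show ?thesis .
qed

lemma form_diff_scale:
  assumes u: "u \<in> L2_H1 P D" and u': "u' \<in> L2_H1 P D" and v: "v \<in> L2_H1 P D" and \<omega>: "\<omega> \<in> space P"
  shows "form k \<epsilon> (\<lambda>\<omega>. u \<omega> - h1_scale c (u' \<omega>)) v \<omega> = form k \<epsilon> u v \<omega> - of_real c * form k \<epsilon> u' v \<omega>"
proof -
  have s: "val (u \<omega> - h1_scale c (u' \<omega>)) x = val (u \<omega>) x - of_real c * val (u' \<omega>) x"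
    "bdry (u \<omega> - h1_scale c (u' \<omega>)) x = bdry (u \<omega>) x - of_real c * bdry (u' \<omega>) x" for \<omega> x
    by (simp_all add: scaleR_conv_of_real)
  have r: "(\<lambda>\<omega>. u \<omega> - h1_scale c (u' \<omega>)) \<in> L2_H1 P D"
    using L2_H1_add_scale[OF D u u', of "- c"] by (simp add: h1_scale_minus)
  note mem = val_mem[OF u] val_mem[OF u'] L2_H1_bdry[OF u] L2_H1_bdry[OF u']
  have q: "quad \<epsilon> (\<lambda>\<omega>. val (u \<omega> - h1_scale c (u' \<omega>)))
      = (\<lambda>\<omega> x. quad \<epsilon> (\<lambda>\<omega>. val (u \<omega>)) \<omega> x - of_real c * quad \<epsilon> (\<lambda>\<omega>. val (u' \<omega>)) \<omega> x)"
    "lin \<epsilon> (\<lambda>\<omega>. bdry (u \<omega> - h1_scale c (u' \<omega>)))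
      = (\<lambda>\<omega> x. lin \<epsilon> (\<lambda>\<omega>. bdry (u \<omega>)) \<omega> x - of_real c * lin \<epsilon> (\<lambda>\<omega>. bdry (u' \<omega>)) \<omega> x)"
    by (simp_all add: fun_eq_iff quad_def lin_def scaleR_conv_of_real algebra_simps)
  \<comment> \<open>The factors a and b stand for -k^2 and ik; the same identity is used for the
    plain values and for their images under \<open>quad\<close> and \<open>lin\<close>.\<close>
  have load: "load (\<lambda>\<omega> x. a * (f \<omega> x - of_real c * f' \<omega> x)) (\<lambda>\<omega> x. b * (g \<omega> x - of_real c * g' \<omega> x)) v \<omega>
      = load (\<lambda>\<omega> x. a * f \<omega> x) (\<lambda>\<omega> x. b * g \<omega> x) v \<omega>
        - of_real c * load (\<lambda>\<omega> x. a * f' \<omega> x) (\<lambda>\<omega> x. b * g' \<omega> x) v \<omega>"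
    if "f \<in> L2_L2 P (lebesgue_on D)" "g \<in> L2_L2 P (surface D)"
      "f' \<in> L2_L2 P (lebesgue_on D)" "g' \<in> L2_L2 P (surface D)" for a b f g f' g'
    using load_diff_cmult[OF L2_L2_cmult[OF that(1), of a] L2_L2_cmult[OF that(2), of b]
        L2_L2_cmult[OF that(3), of a] L2_L2_cmult[OF that(4), of b] v \<omega>, of "of_real c"]
    by (simp add: right_diff_distrib mult.left_commute)
  note g = grad_mem[OF u, THEN bochner_L2_mem, OF \<omega>] grad_mem[OF u', THEN bochner_L2_mem, OF \<omega>]
    grad_mem[OF v, THEN bochner_L2_mem, OF \<omega>]
  show ?thesis
    unfolding form_eq[OF r v \<omega>] form_eq[OF u v \<omega>] form_eq[OF u' v \<omega>] q s
      load[OF mem(1,3,2,4)] load[OF quad_mem[OF mem(1)] lin_mem[OF mem(3)] quad_mem[OF mem(2)] lin_mem[OF mem(4)]]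
      grad_simps L2_inner_vec_diff_scale_left[OF g]
    by (simp add: algebra_simps)
qed

text \<open>At \<epsilon> = 0 the perturbation terms vanish, so changing \<epsilon> adds only a
  \<open>load\<close> term. A solution for the homogeneous medium thereby solves the perturbed
  problem with corrected data.\<close>

lemma form_perturb:
  assumes u: "u \<in> L2_H1 P D" and v: "v \<in> L2_H1 P D" and \<omega>: "\<omega> \<in> space P"
  shows "form k \<epsilon> u v \<omega> = form k 0 u v \<omega>
     + load (\<lambda>\<omega> x. - (of_real k)\<^sup>2 * quad \<epsilon> (\<lambda>\<omega>. val (u \<omega>)) \<omega> x)
         (\<lambda>\<omega> x. \<i> * of_real k * lin \<epsilon> (\<lambda>\<omega>. bdry (u \<omega>)) \<omega> x) v \<omega>"
  unfolding form_eq[OF assms] by (simp add: load_def quad_def lin_def L2_inner_def)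

text \<open>The single step from which the remainder is built: u' is first read as a solution of the
  perturbed problem with corrected data, and then c times it is subtracted.\<close>

lemma weak_solution_diff:
  assumes u: "weak_solution P D k (\<alpha> \<epsilon>) F G u" and u': "weak_solution P D k (\<lambda>\<omega> x. 1) f g u'"
    and F: "F \<in> L2_L2 P (lebesgue_on D)" and G: "G \<in> L2_L2 P (surface D)"
    and f: "f \<in> L2_L2 P (lebesgue_on D)" and g: "g \<in> L2_L2 P (surface D)"
  shows "weak_solution P D k (\<alpha> \<epsilon>)
     (\<lambda>\<omega> x. F \<omega> x - of_real c * (f \<omega> x - (of_real k)\<^sup>2 * quad \<epsilon> (\<lambda>\<omega>. val (u' \<omega>)) \<omega> x))
     (\<lambda>\<omega> x. G \<omega> x - of_real c * (g \<omega> x + \<i> * of_real k * lin \<epsilon> (\<lambda>\<omega>. bdry (u' \<omega>)) \<omega> x))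
     (\<lambda>\<omega>. u \<omega> - h1_scale c (u' \<omega>))"
proof -
  have mu: "u \<in> L2_H1 P D" and eu: "\<And>v. v \<in> L2_H1 P D \<Longrightarrow> (\<integral>\<omega>. form k \<epsilon> u v \<omega> \<partial>P) = (\<integral>\<omega>. load F G v \<omega> \<partial>P)"
    using u unfolding weak_solution_iff by auto
  \<comment> \<open>The coefficient 1 is \<open>\<alpha> 0\<close>, which brings both problems under
    the same form.\<close>
  have "weak_solution P D k (\<alpha> 0) f g u'" using u' by simp
  then have mu': "u' \<in> L2_H1 P D"
    and eu': "\<And>v. v \<in> L2_H1 P D \<Longrightarrow> (\<integral>\<omega>. form k 0 u' v \<omega> \<partial>P) = (\<integral>\<omega>. load f g v \<omega> \<partial>P)"
    unfolding weak_solution_iff by auto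
  define q where "q = (\<lambda>\<omega> x. - (of_real k)\<^sup>2 * quad \<epsilon> (\<lambda>\<omega>. val (u' \<omega>)) \<omega> x)"
  define l where "l = (\<lambda>\<omega> x. \<i> * of_real k * lin \<epsilon> (\<lambda>\<omega>. bdry (u' \<omega>)) \<omega> x)"
  have q: "q \<in> L2_L2 P (lebesgue_on D)" and l: "l \<in> L2_L2 P (surface D)"
    unfolding q_def l_def by (intro L2_L2_cmult quad_mem lin_mem val_mem[OF mu'] L2_H1_bdry[OF mu'])+
  have r: "(\<lambda>\<omega>. u \<omega> - h1_scale c (u' \<omega>)) \<in> L2_H1 P D"
    using L2_H1_add_scale[OF D mu mu', of "- c"] by (simp add: h1_scale_minus)
  have fq: "(\<lambda>\<omega> x. f \<omega> x + q \<omega> x) \<in> L2_L2 P (lebesgue_on D)" and gl: "(\<lambda>\<omega> x. g \<omega> x + l \<omega> x) \<in> L2_L2 P (surface D)"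
    by (intro L2_L2_add f g q l)+
  have "(\<integral>\<omega>. form k \<epsilon> (\<lambda>\<omega>. u \<omega> - h1_scale c (u' \<omega>)) v \<omega> \<partial>P)
      = (\<integral>\<omega>. load (\<lambda>\<omega> x. F \<omega> x - of_real c * (f \<omega> x + q \<omega> x)) (\<lambda>\<omega> x. G \<omega> x - of_real c * (g \<omega> x + l \<omega> x)) v \<omega> \<partial>P)"
    if v: "v \<in> L2_H1 P D" for v
  proof -
    note i = form_integrable[OF mu v] form_integrable[OF mu' v] load_integrable[OF q l v]
      load_integrable[OF F G v] load_integrable[OF f g v]
    have "(\<integral>\<omega>. form k \<epsilon> (\<lambda>\<omega>. u \<omega> - h1_scale c (u' \<omega>)) v \<omega> \<partial>P)
        = (\<integral>\<omega>. form k \<epsilon> u v \<omega> - of_real c * (form k 0 u' v \<omega> + load q l v \<omega>) \<partial>P)"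
      by (rule Bochner_Integration.integral_cong[OF refl])
        (simp add: form_diff_scale[OF mu mu' v] form_perturb[OF mu' v, of _ k \<epsilon>] q_def l_def)
    \<comment> \<open>The two equations hold only in expectation, so the integral is split by
      integrability, each part is exchanged, and the parts are reassembled.\<close>
    also have "\<dots> = (\<integral>\<omega>. load F G v \<omega> - of_real c * (load f g v \<omega> + load q l v \<omega>) \<partial>P)"
      using i by (simp add: eu[OF v] eu'[OF v])
    also have "\<dots> = (\<integral>\<omega>. load (\<lambda>\<omega> x. F \<omega> x - of_real c * (f \<omega> x + q \<omega> x)) (\<lambda>\<omega> x. G \<omega> x - of_real c * (g \<omega> x + l \<omega> x)) v \<omega> \<partial>P)"
    proof (rule Bochner_Integration.integral_cong[OF refl])
      fix \<omega> assume \<omega>: "\<omega> \<in> space P"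
      have "load (\<lambda>\<omega> x. f \<omega> x + q \<omega> x) (\<lambda>\<omega> x. g \<omega> x + l \<omega> x) v \<omega> = load f g v \<omega> + load q l v \<omega>"
        \<comment> \<open>With factor -1 the difference rule becomes additivity.\<close>
        using load_diff_cmult[OF f g q l v \<omega>, of "-1"] by simp
      then show "load F G v \<omega> - of_real c * (load f g v \<omega> + load q l v \<omega>)
          = load (\<lambda>\<omega> x. F \<omega> x - of_real c * (f \<omega> x + q \<omega> x)) (\<lambda>\<omega> x. G \<omega> x - of_real c * (g \<omega> x + l \<omega> x)) v \<omega>"
        by (simp add: load_diff_cmult[OF F G fq gl v \<omega>])
    qed
    finally show ?thesis .
  qed
  with r have "weak_solution P D k (\<alpha> \<epsilon>) (\<lambda>\<omega> x. F \<omega> x - of_real c * (f \<omega> x + q \<omega> x))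
     (\<lambda>\<omega> x. G \<omega> x - of_real c * (g \<omega> x + l \<omega> x)) (\<lambda>\<omega>. u \<omega> - h1_scale c (u' \<omega>))"
    unfolding weak_solution_iff by blast
  then show ?thesis by (simp add: q_def l_def)
qed

end

section \<open>Estimates for the modes and the remainder\<close>

text \<open>The rate 3/4 works because (3/4)/2 + 1/8 = 1/2 \<le> 9/16 = (3/4)^2. The induction
  carries two consecutive indices.\<close>

lemma two_step_recursion:
  fixes b :: "nat \<Rightarrow> real"
  assumes nonneg: "\<And>n. 0 \<le> b n" and rec: "\<And>n. b (Suc (Suc n)) \<le> b (Suc n) / 2 + b n / 8"
  shows "b \<longlonglongrightarrow> 0"
proof -
  \<comment> \<open>Chosen so that \<open>b 0 \<le> K\<close> and
    \<open>b 1 \<le> 3 / 4 * K\<close>.\<close>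
  define K where "K = b 0 + 2 * b 1"
  have "b n \<le> K * (3 / 4) ^ n \<and> b (Suc n) \<le> K * (3 / 4) ^ Suc n" for n
  proof (induction n)
    case 0
    show ?case using nonneg[of 0] nonneg[of 1] by (simp add: K_def)
  next
    case (Suc n)
    have "0 \<le> K * (3 / 4) ^ n" using nonneg[of 0] nonneg[of 1] by (simp add: K_def)
    then show ?case using Suc rec[of n] by simp
  qed
  then have "norm (b n) \<le> K * (3 / 4) ^ n" for n using nonneg by simp
  moreover have "(\<lambda>n. K * (3 / 4 :: real) ^ n) \<longlonglongrightarrow> 0"
    by (intro tendsto_mult_right_zero LIMSEQ_power_zero) simp
  ultimately show ?thesis by (intro Lim_null_comparison[of b "\<lambda>n. K * (3 / 4) ^ n"]) auto
qed

lemma ennreal_lincomb: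
  assumes "0 \<le> a" "0 \<le> x" "0 \<le> b" "0 \<le> y"
  shows "ennreal a * ennreal x + ennreal b * ennreal y = ennreal (a * x + b * y)"
  using assms by (simp add: ennreal_mult ennreal_plus)

text \<open>The quantity propagated by the recursion: the left side of the first a priori estimate
  without the boundary gradient.\<close>

definition energy :: "'w measure \<Rightarrow> (real^'n::finite) set \<Rightarrow> ('w \<Rightarrow> 'n h1) \<Rightarrow> ennreal" where
  "energy P D u =
     (\<integral>\<^sup>+\<omega>. ennreal ((L2_norm (lebesgue_on D) (val (u \<omega>)))\<^sup>2 + (L2_norm (surface D) (bdry (u \<omega>)))\<^sup>2) \<partial>P)"

lemma L2_L2_norm_measurable:
  fixes f :: "'w \<Rightarrow> 'a \<Rightarrow> 'b::{real_normed_vector, second_countable_topology}"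
  shows "f \<in> L2_L2 P \<mu> \<Longrightarrow> (\<lambda>\<omega>. L2_norm \<mu> (f \<omega>)) \<in> borel_measurable P"
  by (rule bochner_L2_norm_measurable[OF seminormed_L2])

context random_medium
begin

text \<open>Lets the energies be treated as real numbers, where the recursion lives.\<close>

lemma energy_finite:
  assumes "v \<in> L2_H1 P D"
  shows "energy P D v < \<infinity>"
proof -
  note m = val_mem[OF assms] L2_H1_bdry[OF assms]
  note [measurable] = m[THEN L2_L2_norm_measurable]
  have "energy P D v = (\<integral>\<^sup>+\<omega>. ennreal ((L2_norm (lebesgue_on D) (val (v \<omega>)))\<^sup>2) \<partial>P)
      + (\<integral>\<^sup>+\<omega>. ennreal ((L2_norm (surface D) (bdry (v \<omega>)))\<^sup>2) \<partial>P)"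
    by (simp add: energy_def nn_integral_add)
  then show ?thesis using m[THEN bochner_L2_finite] by simp
qed

lemma val_le_energy: "(\<integral>\<^sup>+\<omega>. ennreal ((L2_norm (lebesgue_on D) (val (v \<omega>)))\<^sup>2) \<partial>P) \<le> energy P D v"
  unfolding energy_def by (intro nn_integral_mono ennreal_leI) simp

text \<open>The almost sure bound on \<eta> removes it from both data. A common bound C on the two
  coefficients turns the data norm into a multiple of the energy.\<close>

lemma data_norm_sq_mult_le:
  assumes v: "v \<in> L2_H1 P D" and e: "energy P D v \<le> ennreal B" "0 \<le> B" and C: "norm c \<le> C" "norm d \<le> C"
  shows "data_norm_sq P D (\<lambda>\<omega> x. c * (of_real (\<eta> \<omega> x) * val (v \<omega>) x))
     (\<lambda>\<omega> x. d * (of_real (\<eta> \<omega> x) * bdry (v \<omega>) x)) \<le> ennreal (C\<^sup>2 * B)"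
proof -
  note m = val_mem[OF v] L2_H1_bdry[OF v]
  note [measurable] = m[THEN L2_L2_norm_measurable]
  have "data_norm_sq P D (\<lambda>\<omega> x. c * (of_real (\<eta> \<omega> x) * val (v \<omega>) x)) (\<lambda>\<omega> x. d * (of_real (\<eta> \<omega> x) * bdry (v \<omega>) x))
      \<le> (\<integral>\<^sup>+\<omega>. ennreal (C\<^sup>2) * ennreal ((L2_norm (lebesgue_on D) (val (v \<omega>)))\<^sup>2 + (L2_norm (surface D) (bdry (v \<omega>)))\<^sup>2) \<partial>P)"
    unfolding data_norm_sq_def L2_norm_cmult
  proof (intro nn_integral_mono_AE)
    have le: "(norm z * s)\<^sup>2 \<le> C\<^sup>2 * t\<^sup>2" if "norm z \<le> C" "s \<le> t" "0 \<le> s" for z :: complex and s t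
      using that order_trans[OF norm_ge_zero that(1)]
      by (subst power_mult_distrib[symmetric]) (intro power_mono mult_mono, auto)
    show "AE \<omega> in P. ennreal ((norm c * L2_norm (lebesgue_on D) (\<lambda>x. of_real (\<eta> \<omega> x) * val (v \<omega>) x))\<^sup>2
        + (norm d * L2_norm (surface D) (\<lambda>x. of_real (\<eta> \<omega> x) * bdry (v \<omega>) x))\<^sup>2)
      \<le> ennreal (C\<^sup>2) * ennreal ((L2_norm (lebesgue_on D) (val (v \<omega>)))\<^sup>2 + (L2_norm (surface D) (bdry (v \<omega>)))\<^sup>2)"
      using mult_domain(2)[OF m(1)] mult_surface(2)[OF m(2)]
    proof eventually_elim
      case (elim \<omega>)
      show ?case
        using le[OF C(1) elim(1)] le[OF C(2) elim(2)]
        by (simp add: ennreal_mult[symmetric] distrib_left del: ennreal_plus)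
    qed
  qed
  also have "\<dots> = ennreal (C\<^sup>2) * energy P D v" by (simp add: nn_integral_cmult energy_def del: ennreal_plus)
  also have "\<dots> \<le> ennreal (C\<^sup>2) * ennreal B" by (intro mult_left_mono e) simp
  finally show ?thesis using e(2) by (simp add: ennreal_mult)
qed

text \<open>Adds one term quadratic in \<eta> to the interior datum. The factors 2 come from
  \<open>norm_add_square_le\<close>; the multiplication bound, applied twice, removes both factors
  \<eta>.\<close>

lemma data_norm_sq_add_le:
  assumes f: "f \<in> L2_L2 P (lebesgue_on D)" and g: "g \<in> L2_L2 P (surface D)" and w: "w \<in> L2_L2 P (lebesgue_on D)"
    and A: "data_norm_sq P D f g \<le> ennreal A" "0 \<le> A"
    and B: "(\<integral>\<^sup>+\<omega>. ennreal ((L2_norm (lebesgue_on D) (w \<omega>))\<^sup>2) \<partial>P) \<le> ennreal B" "0 \<le> B"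
  shows "data_norm_sq P D (\<lambda>\<omega> x. f \<omega> x + c * (of_real (\<eta> \<omega> x) * (of_real (\<eta> \<omega> x) * w \<omega> x))) g
     \<le> ennreal (2 * A + 2 * (norm c)\<^sup>2 * B)"
proof -
  let ?L = "lebesgue_on D"
  let ?h = "\<lambda>\<omega> x. c * (of_real (\<eta> \<omega> x) * (of_real (\<eta> \<omega> x) * w \<omega> x))"
  note [measurable] = f[THEN L2_L2_norm_measurable] g[THEN L2_L2_norm_measurable] w[THEN L2_L2_norm_measurable]
  have h: "?h \<in> L2_L2 P ?L" by (intro L2_L2_cmult mult_domain(1) w)
  have "data_norm_sq P D (\<lambda>\<omega> x. f \<omega> x + ?h \<omega> x) g
      \<le> (\<integral>\<^sup>+\<omega>. ennreal 2 * ennreal ((L2_norm ?L (f \<omega>))\<^sup>2 + (L2_norm (surface D) (g \<omega>))\<^sup>2)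
          + ennreal (2 * (norm c)\<^sup>2) * ennreal ((L2_norm ?L (w \<omega>))\<^sup>2) \<partial>P)"
    unfolding data_norm_sq_def
  proof (intro nn_integral_mono_AE)
    show "AE \<omega> in P. ennreal ((L2_norm ?L (\<lambda>x. f \<omega> x + ?h \<omega> x))\<^sup>2 + (L2_norm (surface D) (g \<omega>))\<^sup>2)
      \<le> ennreal 2 * ennreal ((L2_norm ?L (f \<omega>))\<^sup>2 + (L2_norm (surface D) (g \<omega>))\<^sup>2)
          + ennreal (2 * (norm c)\<^sup>2) * ennreal ((L2_norm ?L (w \<omega>))\<^sup>2)"
      using mult_domain(2)[OF w] mult_domain(2)[OF mult_domain(1)[OF w]] AE_space
    proof eventually_elim
      case (elim \<omega>)
      have "L2_norm ?L (?h \<omega>) \<le> norm c * L2_norm ?L (w \<omega>)"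
        unfolding L2_norm_cmult using elim(1,2) by (intro mult_left_mono) auto
      then have "(L2_norm ?L (?h \<omega>))\<^sup>2 \<le> (norm c)\<^sup>2 * (L2_norm ?L (w \<omega>))\<^sup>2"
        unfolding power_mult_distrib[symmetric] by (intro power_mono) auto
      moreover have "(L2_norm ?L (\<lambda>x. f \<omega> x + ?h \<omega> x))\<^sup>2 \<le> 2 * (L2_norm ?L (f \<omega>))\<^sup>2 + 2 * (L2_norm ?L (?h \<omega>))\<^sup>2"
        using L2_norm_add_square_le[OF bochner_L2_mem[OF f elim(3)] bochner_L2_mem[OF h elim(3)]]
        by (simp add: plus_fun_def)
      moreover have "0 \<le> (L2_norm (surface D) (g \<omega>))\<^sup>2" by simp
      \<comment> \<open>The boundary term z is doubled together with b, so that the whole previous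
        data norm reappears.\<close>
      moreover have "a + z \<le> 2 * (b + z) + 2 * d * r" if "h \<le> d * r" "a \<le> 2 * b + 2 * h" "0 \<le> z" for a b d h r z :: real
      proof -
        have "2 * h \<le> 2 * (d * r)" using that(1) by (intro mult_left_mono) auto
        then show ?thesis using that(2,3) by (simp add: distrib_left mult.assoc)
      qed
      ultimately have "(L2_norm ?L (\<lambda>x. f \<omega> x + ?h \<omega> x))\<^sup>2 + (L2_norm (surface D) (g \<omega>))\<^sup>2
          \<le> 2 * ((L2_norm ?L (f \<omega>))\<^sup>2 + (L2_norm (surface D) (g \<omega>))\<^sup>2) + 2 * (norm c)\<^sup>2 * (L2_norm ?L (w \<omega>))\<^sup>2"
        by blast
      then show ?case by (subst ennreal_lincomb) (auto intro: ennreal_leI simp del: ennreal_plus)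
    qed
  qed
  also have "\<dots> = ennreal 2 * data_norm_sq P D f g
      + ennreal (2 * (norm c)\<^sup>2) * (\<integral>\<^sup>+\<omega>. ennreal ((L2_norm ?L (w \<omega>))\<^sup>2) \<partial>P)"
    by (simp add: nn_integral_add nn_integral_cmult data_norm_sq_def del: ennreal_plus)
  also have "\<dots> \<le> ennreal 2 * ennreal A + ennreal (2 * (norm c)\<^sup>2) * ennreal B"
    by (intro add_mono mult_left_mono A B) simp_all
  also have "\<dots> = ennreal (2 * A + 2 * (norm c)\<^sup>2 * B)"
    using A(2) B(2) by (intro ennreal_lincomb) auto
  finally show ?thesis .
qed

section \<open>Sources of the modes and of the remainder\<close>

definition mode_source ::
    "real \<Rightarrow> ('w \<Rightarrow> real^'n \<Rightarrow> complex) \<Rightarrow> (int \<Rightarrow> 'w \<Rightarrow> 'n h1) \<Rightarrow> nat \<Rightarrow> 'w \<Rightarrow> real^'n \<Rightarrow> complex" where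
  "mode_source k f u n = (if n = 0 then f
     else (\<lambda>\<omega> x. 2 * (of_real k)\<^sup>2 * (of_real (\<eta> \<omega> x) * val (u (int n - 1) \<omega>) x)
       + (of_real k)\<^sup>2 * (of_real (\<eta> \<omega> x) * (of_real (\<eta> \<omega> x) * val (u (int n - 2) \<omega>) x))))"

definition mode_boundary_source ::
    "real \<Rightarrow> (int \<Rightarrow> 'w \<Rightarrow> 'n h1) \<Rightarrow> nat \<Rightarrow> 'w \<Rightarrow> real^'n \<Rightarrow> complex" where
  "mode_boundary_source k u n = (\<lambda>\<omega> x. - \<i> * of_real k * (of_real (\<eta> \<omega> x) * bdry (u (int n - 1) \<omega>) x))"

text \<open>Inserting a partial sum into the perturbed equation cancels all orders below N. What is
  left comes from the truncation: the full source of mode N at order N, and only the part quadratic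
  in \<eta> at order N + 1.\<close>

definition residual_source ::
    "real \<Rightarrow> real \<Rightarrow> ('w \<Rightarrow> real^'n \<Rightarrow> complex) \<Rightarrow> (int \<Rightarrow> 'w \<Rightarrow> 'n h1) \<Rightarrow> nat \<Rightarrow> 'w \<Rightarrow> real^'n \<Rightarrow> complex" where
  "residual_source k \<epsilon> f u N = (\<lambda>\<omega> x. of_real (\<epsilon> ^ N) * mode_source k f u N \<omega> x
     + of_real (\<epsilon> ^ Suc N * k\<^sup>2) * (of_real (\<eta> \<omega> x) * (of_real (\<eta> \<omega> x) * val (u (int N - 1) \<omega>) x)))"

definition residual_boundary_source ::
    "real \<Rightarrow> real \<Rightarrow> (int \<Rightarrow> 'w \<Rightarrow> 'n h1) \<Rightarrow> nat \<Rightarrow> 'w \<Rightarrow> real^'n \<Rightarrow> complex" where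
  "residual_boundary_source k \<epsilon> u N = (\<lambda>\<omega> x. of_real (\<epsilon> ^ N) * mode_boundary_source k u N \<omega> x)"

context
  fixes k \<epsilon> :: real and f :: "'w \<Rightarrow> real^'n \<Rightarrow> complex" and u :: "int \<Rightarrow> 'w \<Rightarrow> 'n h1"
  assumes f_mem: "f \<in> L2_L2 P (lebesgue_on D)" and modes: "mode_functions P D k \<eta> f u"
begin

lemma mode_minus_one: "u (- 1) = (\<lambda>\<omega>. 0)"
  using modes by (simp add: mode_functions_def zero_fun_def)

text \<open>Passes to natural indices and rewrites the square of \<eta> as iterated multiplication,
  the shape to which the product lemmas apply.\<close>

lemma mode_weak_solution:
  "weak_solution P D k (\<lambda>\<omega> x. 1) (mode_source k f u n) (mode_boundary_source k u n) (u (int n))"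
proof -
  have "(if int n = 0 then f
         else (\<lambda>\<omega> x. 2 * (of_real k)\<^sup>2 * of_real (\<eta> \<omega> x) * val (u (int n - 1) \<omega>) x
                   + (of_real k)\<^sup>2 * (of_real (\<eta> \<omega> x))\<^sup>2 * val (u (int n - 2) \<omega>) x)) = mode_source k f u n"
    "(\<lambda>\<omega> x. - \<i> * of_real k * of_real (\<eta> \<omega> x) * bdry (u (int n - 1) \<omega>) x) = mode_boundary_source k u n"
    by (auto simp: mode_source_def mode_boundary_source_def fun_eq_iff power2_eq_square mult.assoc)
  note eqs = this
  show ?thesis
    using modes[unfolded mode_functions_def, THEN conjunct2, THEN spec[of _ "int n"], THEN mp, OF of_nat_0_le_iff]
    unfolding eqs .
qed

lemma mode_mem: "u (int n) \<in> L2_H1 P D"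
  using mode_weak_solution[of n] by (simp add: weak_solution_def)

text \<open>The index starts at -1 because the source of mode 1 refers to the zero function
  \<open>u (-1)\<close>.\<close>

lemma mode_val_mem: "- 1 \<le> i \<Longrightarrow> (\<lambda>\<omega>. val (u i \<omega>)) \<in> L2_L2 P (lebesgue_on D)"
  and mode_bdry_mem: "- 1 \<le> i \<Longrightarrow> (\<lambda>\<omega>. bdry (u i \<omega>)) \<in> L2_L2 P (surface D)"
proof -
  assume "- 1 \<le> i"
  then consider "i = - 1" | "i = int (nat i)" by linarith
  then have "(\<lambda>\<omega>. val (u i \<omega>)) \<in> L2_L2 P (lebesgue_on D) \<and> (\<lambda>\<omega>. bdry (u i \<omega>)) \<in> L2_L2 P (surface D)"
  proof cases
    case 1
    then show ?thesis by (simp add: mode_minus_one zero_fun_def L2_L2_zero)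
  next
    case 2
    then show ?thesis using val_mem[OF mode_mem] L2_H1_bdry[OF mode_mem] by metis
  qed
  then show "(\<lambda>\<omega>. val (u i \<omega>)) \<in> L2_L2 P (lebesgue_on D)" "(\<lambda>\<omega>. bdry (u i \<omega>)) \<in> L2_L2 P (surface D)" by auto
qed

lemma mode_source_mem: "mode_source k f u n \<in> L2_L2 P (lebesgue_on D)"
  unfolding mode_source_def
  using f_mem by (auto intro!: L2_L2_add L2_L2_cmult mult_domain(1) mode_val_mem)

lemma mode_boundary_source_mem: "mode_boundary_source k u n \<in> L2_L2 P (surface D)"
  unfolding mode_boundary_source_def
  by (intro L2_L2_cmult mult_surface(1) mode_bdry_mem) simp

lemma residual_source_mem: "residual_source k \<epsilon> f u N \<in> L2_L2 P (lebesgue_on D)"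
  unfolding residual_source_def
  by (intro L2_L2_add L2_L2_cmult mult_domain(1) mode_val_mem mode_source_mem) simp

lemma residual_boundary_source_mem: "residual_boundary_source k \<epsilon> u N \<in> L2_L2 P (surface D)"
  unfolding residual_boundary_source_def by (intro L2_L2_cmult mode_boundary_source_mem)

text \<open>Subtracting \<open>\<epsilon> ^ N\<close> times mode N removes its source and creates
  \<open>quad\<close> terms of orders N + 1 and N + 2. The old leftover of order N + 1 joins the new
  linear term to form the source of mode N + 1; the term of order N + 2 is the new leftover.\<close>

lemma residual_weak_solution:
  assumes u\<epsilon>: "weak_solution P D k (\<alpha> \<epsilon>) f (\<lambda>\<omega> x. 0) u\<epsilon>"
  shows "weak_solution P D k (\<alpha> \<epsilon>) (residual_source k \<epsilon> f u N) (residual_boundary_source k \<epsilon> u N)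
     (\<lambda>\<omega>. u\<epsilon> \<omega> - (\<Sum>n<N. h1_scale (\<epsilon> ^ n) (u (int n) \<omega>)))"
proof (induction N)
  case 0
  have "residual_source k \<epsilon> f u 0 = f" "residual_boundary_source k \<epsilon> u 0 = (\<lambda>\<omega> x. 0)"
    by (simp_all add: residual_source_def residual_boundary_source_def mode_source_def
        mode_boundary_source_def mode_minus_one fun_eq_iff)
  with u\<epsilon> show ?case by simp
next
  case (Suc N)
  have "(\<lambda>\<omega> x. residual_source k \<epsilon> f u N \<omega> x - of_real (\<epsilon> ^ N) *
      (mode_source k f u N \<omega> x - (of_real k)\<^sup>2 * quad \<epsilon> (\<lambda>\<omega>. val (u (int N) \<omega>)) \<omega> x)) = residual_source k \<epsilon> f u (Suc N)"
    by (simp add: fun_eq_iff residual_source_def quad_def mode_source_def[of _ _ _ "Suc N"] power2_eq_square algebra_simps)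
  moreover have "(\<lambda>\<omega> x. residual_boundary_source k \<epsilon> u N \<omega> x - of_real (\<epsilon> ^ N) *
      (mode_boundary_source k u N \<omega> x + \<i> * of_real k * lin \<epsilon> (\<lambda>\<omega>. bdry (u (int N) \<omega>)) \<omega> x))
      = residual_boundary_source k \<epsilon> u (Suc N)"
    by (simp add: fun_eq_iff residual_boundary_source_def mode_boundary_source_def lin_def algebra_simps)
  ultimately show ?case
    using weak_solution_diff[OF Suc mode_weak_solution residual_source_mem residual_boundary_source_mem
        mode_source_mem mode_boundary_source_mem, where c = "\<epsilon> ^ N", of N]
    by (simp only: diff_diff_eq sum.lessThan_Suc)
qed

text \<open>The coefficient 8 is 2 times the square of the 2 in \<open>2 * k\<^sup>2\<close>; the
  other 2 belongs to the quadratic term. From index 2 on, both predecessors are modes with natural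
  index.\<close>

lemma mode_data_le:
  assumes k: "1 \<le> k" and e: "\<And>n. energy P D (u (int n)) \<le> ennreal (e n)" "\<And>n. 0 \<le> e n"
  shows "data_norm_sq P D (mode_source k f u (Suc (Suc n))) (mode_boundary_source k u (Suc (Suc n)))
     \<le> ennreal (8 * k ^ 4 * e (Suc n) + 2 * k ^ 4 * e n)"
proof -
  \<comment> \<open>The boundary coefficient k is absorbed into the interior coefficient
    \<open>2 * k\<^sup>2\<close>, giving a common bound.\<close>
  have k2: "k \<le> 2 * k\<^sup>2" using k by (simp add: power2_eq_square)
  have i: "int (Suc (Suc n)) - 1 = int (Suc n)" "int (Suc (Suc n)) - 2 = int n" by simp_all
  have "data_norm_sq P D (mode_source k f u (Suc (Suc n))) (mode_boundary_source k u (Suc (Suc n)))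
    \<le> ennreal (2 * ((2 * k\<^sup>2)\<^sup>2 * e (Suc n)) + 2 * (norm ((complex_of_real k)\<^sup>2))\<^sup>2 * e n)"
    unfolding mode_source_def mode_boundary_source_def i using k k2
    by (simp only: nat.simps if_False, intro data_norm_sq_add_le data_norm_sq_mult_le L2_L2_cmult mult_domain(1)
        mult_surface(1) mode_val_mem mode_bdry_mem mode_mem e order_trans[OF val_le_energy])
      (auto simp: norm_mult norm_power e)
  also have "2 * ((2 * k\<^sup>2)\<^sup>2 * e (Suc n)) + 2 * (norm ((complex_of_real k)\<^sup>2))\<^sup>2 * e n
      = 8 * k ^ 4 * e (Suc n) + 2 * k ^ 4 * e n"
    by (simp add: norm_power power_mult_distrib)
  finally show ?thesis .
qed

text \<open>There are two quadratic terms, hence two doublings: 20 = 2 * (2 * 4 + 2), with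
  \<epsilon> \<le> 1 used for the higher-order one. The smaller coefficient 2 of \<open>e n\<close>
  is raised to 20 as well.\<close>

lemma residual_data_le:
  assumes k: "1 \<le> k" and \<epsilon>: "0 < \<epsilon>" "\<epsilon> \<le> 1"
    and e: "\<And>n. energy P D (u (int n)) \<le> ennreal (e n)" "\<And>n. 0 \<le> e n"
  shows "data_norm_sq P D (residual_source k \<epsilon> f u (Suc (Suc n))) (residual_boundary_source k \<epsilon> u (Suc (Suc n)))
     \<le> ennreal (20 * k ^ 4 * (\<epsilon> ^ (2 * Suc n) * e (Suc n) + \<epsilon> ^ (2 * n) * e n))"
proof -
  let ?N = "Suc (Suc n)"
  let ?v = "\<lambda>\<omega>. val (u (int (Suc n)) \<omega>)" and ?w = "\<lambda>\<omega>. val (u (int n) \<omega>)"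
  let ?b = "\<lambda>\<omega>. bdry (u (int (Suc n)) \<omega>)"
  define c where "c = \<epsilon> ^ ?N * k\<^sup>2"
  have k2: "k \<le> 2 * k\<^sup>2" using k by (simp add: power2_eq_square)
  have c: "0 \<le> c" using \<epsilon> by (simp add: c_def)
  have i: "int ?N - 1 = int (Suc n)" "int ?N - 2 = int n" by simp_all
  \<comment> \<open>Grouped so that the first term pairs with the boundary source under
    \<open>data_norm_sq_mult_le\<close>; each further term then costs one use of
    \<open>data_norm_sq_add_le\<close>.\<close>
  have src: "residual_source k \<epsilon> f u ?N = (\<lambda>\<omega> x. (of_real (2 * c) * (of_real (\<eta> \<omega> x) * ?v \<omega> x)
      + of_real (\<epsilon> * c) * (of_real (\<eta> \<omega> x) * (of_real (\<eta> \<omega> x) * ?v \<omega> x)))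
      + of_real c * (of_real (\<eta> \<omega> x) * (of_real (\<eta> \<omega> x) * ?w \<omega> x)))"
    unfolding residual_source_def mode_source_def i
    by (simp add: fun_eq_iff c_def power2_eq_square algebra_simps)
  have bsrc: "residual_boundary_source k \<epsilon> u ?N = (\<lambda>\<omega> x. (- \<i> * of_real (\<epsilon> ^ ?N * k)) * (of_real (\<eta> \<omega> x) * ?b \<omega> x))"
    unfolding residual_boundary_source_def mode_boundary_source_def i by (simp add: fun_eq_iff algebra_simps)
  have "\<epsilon> ^ ?N * k \<le> \<epsilon> ^ ?N * (2 * k\<^sup>2)" using k2 \<epsilon> by (intro mult_left_mono) auto
  then have d: "norm (- \<i> * complex_of_real (\<epsilon> ^ ?N * k)) \<le> 2 * c"
    using k \<epsilon> by (simp add: norm_mult norm_power c_def algebra_simps)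
  have "data_norm_sq P D (residual_source k \<epsilon> f u ?N) (residual_boundary_source k \<epsilon> u ?N)
    \<le> ennreal (2 * (2 * ((2 * c)\<^sup>2 * e (Suc n)) + 2 * (norm (complex_of_real (\<epsilon> * c)))\<^sup>2 * e (Suc n))
        + 2 * (norm (complex_of_real c))\<^sup>2 * e n)"
    unfolding src bsrc using k c d
    by (intro data_norm_sq_add_le data_norm_sq_mult_le L2_L2_add L2_L2_cmult mult_domain(1)
        mult_surface(1) mode_val_mem mode_bdry_mem mode_mem e order_trans[OF val_le_energy])
      (auto simp: norm_mult norm_power e)
  also have "\<dots> \<le> ennreal (20 * k ^ 4 * (\<epsilon> ^ (2 * Suc n) * e (Suc n) + \<epsilon> ^ (2 * n) * e n))"
  proof (rule ennreal_leI)
    have \<epsilon>2: "\<epsilon>\<^sup>2 \<le> 1" using \<epsilon> by (simp add: power_le_one)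
    have cc: "c\<^sup>2 = k ^ 4 * \<epsilon> ^ (2 * Suc n) * \<epsilon>\<^sup>2"
      by (simp add: c_def power_mult_distrib power_mult[symmetric] power_add[symmetric] mult.commute)
    \<comment> \<open>Powers of \<epsilon> are given away so that each energy keeps exactly the
      weight it has in the recursion.\<close>
    have c1: "c\<^sup>2 \<le> k ^ 4 * \<epsilon> ^ (2 * Suc n)" unfolding cc using \<epsilon>2 \<epsilon> k by (intro mult_right_le_one_le) auto
    have c2: "c\<^sup>2 \<le> k ^ 4 * \<epsilon> ^ (2 * n)"
      using c1 power_decreasing[of "2 * n" "2 * Suc n" \<epsilon>] \<epsilon> k by (elim order_trans) (intro mult_left_mono, auto)
    have "(\<epsilon> * c)\<^sup>2 \<le> c\<^sup>2" unfolding power_mult_distrib using \<epsilon>2 by (intro mult_left_le_one_le) auto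
    then have "2 * (2 * ((2 * c)\<^sup>2 * e (Suc n)) + 2 * (\<epsilon> * c)\<^sup>2 * e (Suc n)) + 2 * c\<^sup>2 * e n
        \<le> 2 * (2 * ((2 * c)\<^sup>2 * e (Suc n)) + 2 * c\<^sup>2 * e (Suc n)) + 2 * c\<^sup>2 * e n"
      using e(2) by (intro add_mono mult_left_mono mult_right_mono) auto
    also have "\<dots> = 20 * (c\<^sup>2 * e (Suc n)) + 2 * (c\<^sup>2 * e n)" by (simp add: power_mult_distrib)
    also have "\<dots> \<le> 20 * (k ^ 4 * \<epsilon> ^ (2 * Suc n) * e (Suc n)) + 20 * (k ^ 4 * \<epsilon> ^ (2 * n) * e n)"
      using mult_right_mono[OF c1 e(2)[of "Suc n"]] mult_right_mono[OF c2 e(2)[of n]]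
        mult_nonneg_nonneg[OF zero_le_power2[of c] e(2)[of n]] by linarith
    finally show "2 * (2 * ((2 * c)\<^sup>2 * e (Suc n)) + 2 * (norm (complex_of_real (\<epsilon> * c)))\<^sup>2 * e (Suc n))
        + 2 * (norm (complex_of_real c))\<^sup>2 * e n
        \<le> 20 * k ^ 4 * (\<epsilon> ^ (2 * Suc n) * e (Suc n) + \<epsilon> ^ (2 * n) * e n)"
      by (simp add: distrib_left mult.assoc norm_mult power_mult_distrib)
  qed
  finally show ?thesis .
qed

end

end

lemma stability_constantD:
  fixes P :: "'w measure" and D :: "(real^'n::finite) set"
  assumes "stability_constant P D c\<^sub>0 \<eta> C\<^sub>0" "0 \<le> c\<^sub>0" "1 \<le> k" "0 \<le> \<epsilon>" "\<epsilon> * (2 + \<epsilon>) < gamma0 CARD('n) k"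
    and "f \<in> L2_L2 P (lebesgue_on D)" "g \<in> L2_L2 P (surface D)"
    and "weak_solution P D k (\<lambda>\<omega> x. 1 + \<epsilon> * \<eta> \<omega> x) f g u"
  shows "energy P D u \<le> ennreal (C\<^sub>0 * (1 / k + 1 / k\<^sup>2)\<^sup>2) * data_norm_sq P D f g"
    and "(\<integral>\<^sup>+\<omega>. ennreal ((H1_norm D (u \<omega>))\<^sup>2) \<partial>P) \<le> ennreal (C\<^sub>0 * (1 + 1 / k\<^sup>2)\<^sup>2) * data_norm_sq P D f g"
proof -
  note stab = assms(1)[unfolded stability_constant_def, THEN conjunct2, rule_format, OF assms(3-8)]
  then obtain H :: "'w \<Rightarrow> real^'n \<Rightarrow> complex^'n" where H: "(\<integral>\<^sup>+\<omega>. ennreal ((L2_norm (lebesgue_on D) (val (u \<omega>)))\<^sup>2 + (L2_norm (surface D) (bdry (u \<omega>)))\<^sup>2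
                 + c\<^sub>0 * (L2_norm (surface D) (H \<omega>))\<^sup>2) \<partial>P)
          \<le> ennreal (C\<^sub>0 * (1 / k + 1 / k\<^sup>2)\<^sup>2) * data_norm_sq P D f g"
    by blast
  show "energy P D u \<le> ennreal (C\<^sub>0 * (1 / k + 1 / k\<^sup>2)\<^sup>2) * data_norm_sq P D f g"
    unfolding energy_def
    by (rule order_trans[OF nn_integral_mono H]) (use assms(2) in \<open>auto intro!: ennreal_leI simp del: ennreal_plus\<close>)
  show "(\<integral>\<^sup>+\<omega>. ennreal ((H1_norm D (u \<omega>))\<^sup>2) \<partial>P) \<le> ennreal (C\<^sub>0 * (1 + 1 / k\<^sup>2)\<^sup>2) * data_norm_sq P D f g"
    using stab by (rule conjunct2)
qed

theorem theorem3p2: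
  fixes P :: "'w measure" and D :: "(real^'n::finite) set"
    and k \<epsilon> c\<^sub>0 C\<^sub>0 :: real
    and \<eta> :: "'w \<Rightarrow> real^'n \<Rightarrow> real"
    and f :: "'w \<Rightarrow> real^'n \<Rightarrow> complex"
    and u\<epsilon> :: "'w \<Rightarrow> 'n h1" and u :: "int \<Rightarrow> 'w \<Rightarrow> 'n h1"
  assumes "prob_space P"
    and "CARD('n) \<in> {1, 2, 3}"
    and "convex_polygonal_domain D" and "D \<subseteq> ball 0 1"
    and "c\<^sub>0 > 0" and "star_shaped D c\<^sub>0"
    and "k \<ge> 1" and "\<epsilon> > 0"
    and "\<eta> \<in> L2_Linf P (lebesgue_on D)"
    and "AE \<omega> in P. Linf_norm (lebesgue_on D) (\<eta> \<omega>) \<le> 1"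
    and "\<eta> \<in> L2_Linf P (surface D)"
    and "AE \<omega> in P. AE x in surface D. \<bar>\<eta> \<omega> x\<bar> \<le> 1"
    and "stability_constant P D c\<^sub>0 \<eta> C\<^sub>0"
    and "\<epsilon> * (2 + \<epsilon>) < gamma0 CARD('n) k"
    and "f \<in> L2_L2 P (lebesgue_on D)"
    and "weak_solution P D k (\<lambda>\<omega> x. 1 + \<epsilon> * \<eta> \<omega> x) f (\<lambda>\<omega> x. 0) u\<epsilon>"
    and "mode_functions P D k \<eta> f u"
    and "4 * \<epsilon> * sqrt C\<^sub>0 * (1 + k) < 1"
  shows "(\<lambda>N. \<integral>\<^sup>+\<omega>. ennreal ((H1_norm D
            (u\<epsilon> \<omega> - (\<Sum>n<N. h1_scale (\<epsilon> ^ n) (u (int n) \<omega>))))\<^sup>2) \<partial>P) \<longlonglongrightarrow> 0"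
proof -
  have k: "1 \<le> k" and \<epsilon>: "0 < \<epsilon>" and c0: "0 \<le> c\<^sub>0" using assms(5,7,8) by auto
  \<comment> \<open>The bound on the essential supremum is turned into the pointwise bound that
    \<open>random_medium\<close> asks for.\<close>
  have "AE \<omega> in P. AE x in lebesgue_on D. \<bar>\<eta> \<omega> x\<bar> \<le> 1"
    using assms(10) AE_space
  proof eventually_elim
    case (elim \<omega>)
    then show ?case
      using Linf_AE_le_norm[OF bochner_L2_mem[OF assms(9) elim(2)]] by (auto elim: eventually_mono)
  qed
  then interpret random_medium P D \<eta>
    using assms(3,9,11,12) by unfold_locales
  note stab = stability_constantD[OF assms(13) c0 k]
  have C0: "0 < C\<^sub>0" using assms(13) by (simp add: stability_constant_def)
  \<comment> \<open>The smallness condition yields two facts: \<open>gamma0\<close> is positive,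
    which admits the estimate at \<epsilon> = 0, and \<epsilon> \<le> 1, since \<open>gamma0\<close>
    is at most 1.\<close>
  have "0 < \<epsilon> * (2 + \<epsilon>)" "gamma0 CARD('n) k \<le> 1" using \<epsilon> by (simp_all add: gamma0_def)
  with assms(14) have gamma: "0 < gamma0 CARD('n) k" "\<epsilon> * (2 + \<epsilon>) < 1" by linarith+
  have "\<epsilon> * 1 \<le> \<epsilon> * (2 + \<epsilon>)" using \<epsilon> by (intro mult_left_mono) auto
  with gamma have \<epsilon>1: "\<epsilon> \<le> 1" by simp
  define e where "e n = enn2real (energy P D (u (int n)))" for n :: nat
  have e: "energy P D (u (int n)) = ennreal (e n)" for n
    using energy_finite[OF mode_mem[OF assms(15,17)], of n] by (simp add: e_def)
  have e0: "0 \<le> e n" for n by (simp add: e_def)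
  \<comment> \<open>The squared power of \<epsilon> is the weight with which the energy of mode n
    enters the squared norm of its series term.\<close>
  define b where "b n = \<epsilon> ^ (2 * n) * e n" for n
  have b0: "0 \<le> b n" for n using e0 by (simp add: b_def)
  have "b \<longlonglongrightarrow> 0"
  proof (rule two_step_recursion[OF b0])
    fix n
    \<comment> \<open>The a priori estimate at \<epsilon> = 0, where the coefficient reduces to
      1.\<close>
    have "energy P D (u (int (Suc (Suc n)))) \<le> ennreal (C\<^sub>0 * (1 / k + 1 / k\<^sup>2)\<^sup>2) *
        data_norm_sq P D (mode_source k f u (Suc (Suc n))) (mode_boundary_source k u (Suc (Suc n)))"
      using gamma(1) mode_weak_solution[OF assms(15,17), of "Suc (Suc n)"]
      by (intro stab(1)[of 0] mode_source_mem[OF assms(15,17)] mode_boundary_source_mem[OF assms(15,17)]) auto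
    also have "\<dots> \<le> ennreal (C\<^sub>0 * (1 / k + 1 / k\<^sup>2)\<^sup>2) * ennreal (8 * k ^ 4 * e (Suc n) + 2 * k ^ 4 * e n)"
      by (intro mult_left_mono mode_data_le[OF assms(15,17) k] e0) (auto simp: e)
    also have "\<dots> = ennreal (C\<^sub>0 * (1 / k + 1 / k\<^sup>2)\<^sup>2 * (8 * k ^ 4 * e (Suc n) + 2 * k ^ 4 * e n))"
      using C0 e0 by (intro ennreal_mult[symmetric]) auto
    finally have "e (Suc (Suc n)) \<le> C\<^sub>0 * (1 / k + 1 / k\<^sup>2)\<^sup>2 * (8 * k ^ 4 * e (Suc n) + 2 * k ^ 4 * e n)"
      unfolding e using C0 e0 k by (subst (asm) ennreal_le_iff) auto
    \<comment> \<open>Splitting \<open>k ^ 4\<close> as a square moves \<open>k\<^sup>2\<close> into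
      the bracket; this is the origin of the factor 1 + k in \<sigma>.\<close>
    also have "\<dots> = C\<^sub>0 * ((1 / k + 1 / k\<^sup>2) * k\<^sup>2)\<^sup>2 * (8 * e (Suc n) + 2 * e n)"
    proof -
      have "k ^ 4 = (k\<^sup>2)\<^sup>2" by simp
      then show ?thesis by (simp only: power_mult_distrib) (simp add: algebra_simps)
    qed
    also have "(1 / k + 1 / k\<^sup>2) * k\<^sup>2 = 1 + k" using k by (simp add: field_simps power2_eq_square)
    finally have rec: "e (Suc (Suc n)) \<le> C\<^sub>0 * (1 + k)\<^sup>2 * (8 * e (Suc n) + 2 * e n)" .
    \<comment> \<open>Squaring the bound on \<sigma> gives the 1/16 that makes the recursion
      contract.\<close>
    have "(4 * \<epsilon> * sqrt C\<^sub>0 * (1 + k))\<^sup>2 \<le> 1"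
      using assms(18) \<epsilon> k C0 by (intro power_le_one) auto
    then have s: "\<epsilon>\<^sup>2 * (C\<^sub>0 * (1 + k)\<^sup>2) \<le> 1 / 16" using C0 by (simp add: power_mult_distrib)
    have "b (Suc (Suc n)) \<le> \<epsilon> ^ (2 * Suc (Suc n)) * (C\<^sub>0 * (1 + k)\<^sup>2 * (8 * e (Suc n) + 2 * e n))"
      unfolding b_def using \<epsilon> by (intro mult_left_mono rec) auto
    also have "\<dots> = (\<epsilon>\<^sup>2 * (C\<^sub>0 * (1 + k)\<^sup>2)) * (8 * b (Suc n) + 2 * \<epsilon>\<^sup>2 * b n)"
      by (simp add: b_def algebra_simps power2_eq_square)
    also have "\<dots> \<le> 1 / 16 * (8 * b (Suc n) + 2 * 1 * b n)"
      using s \<epsilon> \<epsilon>1 b0 by (intro mult_mono add_mono mult_left_mono mult_right_mono power_le_one) auto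
    finally show "b (Suc (Suc n)) \<le> b (Suc n) / 2 + b n / 8" by simp
  qed
  then have "(\<lambda>n. C\<^sub>0 * (1 + 1 / k\<^sup>2)\<^sup>2 * (20 * k ^ 4 * (b (Suc n) + b n))) \<longlonglongrightarrow> C\<^sub>0 * (1 + 1 / k\<^sup>2)\<^sup>2 * (20 * k ^ 4 * (0 + 0))"
    by (intro tendsto_intros LIMSEQ_Suc)
  then have lim: "(\<lambda>n. ennreal (C\<^sub>0 * (1 + 1 / k\<^sup>2)\<^sup>2 * (20 * k ^ 4 * (b (Suc n) + b n)))) \<longlonglongrightarrow> 0"
    using tendsto_ennrealI by fastforce
  define R where "R N = (\<integral>\<^sup>+\<omega>. ennreal ((H1_norm D
            (u\<epsilon> \<omega> - (\<Sum>n<N. h1_scale (\<epsilon> ^ n) (u (int n) \<omega>))))\<^sup>2) \<partial>P)" for N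
  have "R (n + 2) \<le> ennreal (C\<^sub>0 * (1 + 1 / k\<^sup>2)\<^sup>2 * (20 * k ^ 4 * (b (Suc n) + b n)))" for n
  proof -
    \<comment> \<open>The remainder solves the perturbed problem, so here the estimate is used at
      the actual \<epsilon>, and in its \<open>H\<^sup>1\<close> form.\<close>
    have "R (n + 2) \<le> ennreal (C\<^sub>0 * (1 + 1 / k\<^sup>2)\<^sup>2) *
        data_norm_sq P D (residual_source k \<epsilon> f u (n + 2)) (residual_boundary_source k \<epsilon> u (n + 2))"
      unfolding R_def using \<epsilon> assms(14)
      by (intro stab(2)[of \<epsilon>] residual_source_mem[OF assms(15,17)] residual_boundary_source_mem[OF assms(15,17)]
          residual_weak_solution[OF assms(15,17,16)]) auto
    also have "\<dots> \<le> ennreal (C\<^sub>0 * (1 + 1 / k\<^sup>2)\<^sup>2) * ennreal (20 * k ^ 4 * (b (Suc n) + b n))"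
      using residual_data_le[OF assms(15,17) k \<epsilon> \<epsilon>1 eq_refl[OF e] e0, of n]
      unfolding b_def add_2_eq_Suc' by (rule mult_left_mono) simp
    finally show ?thesis using C0 b0 by (subst ennreal_mult) auto
  qed
  \<comment> \<open>The bound concerns remainders from N = 2 on; the shift by two is undone
    afterwards.\<close>
  then have "(\<lambda>n. R (n + 2)) \<longlonglongrightarrow> 0"
    by (intro tendsto_sandwich[OF _ _ tendsto_const lim]) auto
  then show ?thesis unfolding R_def by (rule LIMSEQ_offset)
qed

end
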